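(* Let $m,n,s,k$ be integers such that $3\leqslant s\leqslant n$, $3\leqslant k\leqslant m$, $ms=nk$ and $nk\equiv 0$ or $3 \pmod 4$. If $k$ is odd, $k\geqslant 7\cdot\gcd(k,s)$, and $s\notin\{3,5,6,10\}$, then there exists an integer Heffter array $\mathrm{H}(m,n;s,k)$.
   Context: An integer Heffter array $\mathrm{H}(m,n;s,k)$ is an $m\times n$ partially filled array whose entries are integers from $\{\pm1,\pm2,\ldots,\pm nk\}$ such that: each row contains exactly $s$ filled cells and each column contains exactly $k$ filled cells; no two entries have the same absolute value; and the entries of every row and of every column sum to $0$. *)

theory Defs
  imports Main
begin

definition filled :: "(nat \<Rightarrow> nat \<Rightarrow> int option) \<Rightarrow> nat \<Rightarrow> nat \<Rightarrow> (nat \<times> nat) set" where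
  "filled A m n = {(i, j). i < m \<and> j < n \<and> A i j \<noteq> None}"

definition heffter_int :: "nat \<Rightarrow> nat \<Rightarrow> nat \<Rightarrow> nat \<Rightarrow> (nat \<Rightarrow> nat \<Rightarrow> int option) \<Rightarrow> bool" where
  "heffter_int m n s k A \<longleftrightarrow>
     (\<forall>i j. (i \<ge> m \<or> j \<ge> n) \<longrightarrow> A i j = None) \<and>
     (\<forall>i<m. card {j. j < n \<and> A i j \<noteq> None} = s) \<and>
     (\<forall>j<n. card {i. i < m \<and> A i j \<noteq> None} = k) \<and>
     (\<forall>(i, j) \<in> filled A m n. the (A i j) \<noteq> 0 \<and> \<bar>the (A i j)\<bar> \<le> int (n * k)) \<and>
     inj_on (\<lambda>(i, j). \<bar>the (A i j)\<bar>) (filled A m n) \<and>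
     (\<forall>i<m. (\<Sum>j\<in>{j. j < n \<and> A i j \<noteq> None}. the (A i j)) = 0) \<and>
     (\<forall>j<n. (\<Sum>i\<in>{i. i < m \<and> A i j \<noteq> None}. the (A i j)) = 0)"

end

(* With a = k / gcd k s, it suffices to find c = m / a arrays with a rows and s columns, all lines of
   sum 0, whose absolute values are 1, ..., a s c: each of them is cut vertically into gcd k s blocks,
   and the blocks are placed along cyclic diagonals.

   The odd height a is 3 + 4t or 9 + 4t. The upper 3 rows consist of columns (x, y, -z), where x runs
   through an interval X and z - y through consecutive odd numbers, so x + y - z is 0 for the x in odd
   position and 1 for those in even position. Consecutive columns taken with opposite signs have row
   sums (2, -1, -1) up to sign and order, so a few such pairs cancel; for odd s three columns with
   x + y = z are rotated against each other first. The surplus (1, -1) of a pair is absorbed by the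
   4t rows below, which are cut into 4 x 4 and 4 x 6 arrays on consecutive numbers. If a = 9 + 4t,
   three bands are stacked so that their surpluses cancel, which takes care of the parity of the sum.
   For odd s the left three columns of the lower rows are a transposed band. *)

theory Submission
  imports Defs "HOL-Combinatorics.Permutations"
begin

section \<open>Arrays with prescribed line sums\<close>

text \<open>Only the multiset of absolute values is kept, so that glueing arrays adds multisets and
  lines may be permuted freely. That no value repeats is read off at the end, when the multisets of
  all arrays add up to an interval.\<close>

definition realizable :: "int multiset \<Rightarrow> int list \<Rightarrow> int list \<Rightarrow> bool" where
  "realizable M R C \<longleftrightarrow> (\<exists>A.
     (\<forall>i<length R. (\<Sum>j<length C. A i j) = R ! i) \<and>
     (\<forall>j<length C. (\<Sum>i<length R. A i j) = C ! j) \<and>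
     (\<Sum>i<length R. \<Sum>j<length C. {#\<bar>A i j\<bar>#}) = M)"

lemma realizable_transpose:
  assumes "realizable M R C"
  shows "realizable M C R"
proof -
  from assms obtain A where
    "\<forall>i<length R. (\<Sum>j<length C. A i j) = R ! i"
    "\<forall>j<length C. (\<Sum>i<length R. A i j) = C ! j"
    "(\<Sum>i<length R. \<Sum>j<length C. {#\<bar>A i j\<bar>#}) = M"
    unfolding realizable_def by blast
  then show ?thesis
    unfolding realizable_def
    by (intro exI[of _ "\<lambda>j i. A i j"] conjI, simp, simp) (subst sum.swap, simp)
qed

lemma realizable_uminus:
  assumes "realizable M R C"
  shows "realizable M (map uminus R) (map uminus C)"
proof -
  from assms obtain A where
    "\<forall>i<length R. (\<Sum>j<length C. A i j) = R ! i"
    "\<forall>j<length C. (\<Sum>i<length R. A i j) = C ! j"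
    "(\<Sum>i<length R. \<Sum>j<length C. {#\<bar>A i j\<bar>#}) = M"
    unfolding realizable_def by blast
  then show ?thesis
    unfolding realizable_def
    by (intro exI[of _ "\<lambda>i j. - A i j"]) (auto simp: sum_negf)
qed

lemma sum_lessThan_add:
  fixes f :: "nat \<Rightarrow> 'a::comm_monoid_add"
  shows "(\<Sum>i<m + n. f i) = (\<Sum>i<m. f i) + (\<Sum>i<n. f (m + i))"
  by (induction n) (simp_all add: add.assoc)

lemma realizable_append_cols:
  assumes "realizable M R C" "realizable M' R' C'" "length R = length R'"
  shows "realizable (M + M') (map2 (+) R R') (C @ C')"
proof -
  from assms(1) obtain A where A:
    "\<And>i. i < length R \<Longrightarrow> (\<Sum>j<length C. A i j) = R ! i"
    "\<And>j. j < length C \<Longrightarrow> (\<Sum>i<length R. A i j) = C ! j"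
    "(\<Sum>i<length R. \<Sum>j<length C. {#\<bar>A i j\<bar>#}) = M"
    unfolding realizable_def by blast
  from assms(2) obtain B where B:
    "\<And>i. i < length R' \<Longrightarrow> (\<Sum>j<length C'. B i j) = R' ! i"
    "\<And>j. j < length C' \<Longrightarrow> (\<Sum>i<length R'. B i j) = C' ! j"
    "(\<Sum>i<length R'. \<Sum>j<length C'. {#\<bar>B i j\<bar>#}) = M'"
    unfolding realizable_def by blast
  show ?thesis
    unfolding realizable_def
    by (intro exI[of _ "\<lambda>i j. if j < length C then A i j else B i (j - length C)"])
       (use A B assms(3) in \<open>auto simp: sum_lessThan_add sum.distrib nth_append\<close>)
qed

lemma realizable_append_rows:
  assumes "realizable M R C" "realizable M' R' C'" "length C = length C'"
  shows "realizable (M + M') (R @ R') (map2 (+) C C')"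
  by (rule realizable_transpose[OF realizable_append_cols[OF realizable_transpose[OF assms(1)]
      realizable_transpose[OF assms(2)] assms(3)]])

lemma realizable_permute_cols:
  assumes "realizable M R C" "mset C = mset C'"
  shows "realizable M R C'"
proof -
  from assms(1) obtain A where A:
    "\<And>i. i < length R \<Longrightarrow> (\<Sum>j<length C. A i j) = R ! i"
    "\<And>j. j < length C \<Longrightarrow> (\<Sum>i<length R. A i j) = C ! j"
    "(\<Sum>i<length R. \<Sum>j<length C. {#\<bar>A i j\<bar>#}) = M"
    unfolding realizable_def by blast
  from assms(2)[symmetric] obtain \<pi> where
    \<pi>: "\<pi> permutes {..<length C}" "permute_list \<pi> C = C'"
    by (rule mset_eq_permutation)
  have len: "length C' = length C"
    using assms(2) by (metis size_mset)
  have nth: "C' ! j = C ! \<pi> j" if "j < length C" for j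
    using \<pi> that permute_list_nth by blast
  have reindex: "(\<Sum>j<length C. f (\<pi> j)) = (\<Sum>j<length C. f j)" for f :: "nat \<Rightarrow> 'c::comm_monoid_add"
    using sum.permute[OF \<pi>(1), of f] by (simp add: comp_def)
  have lt: "\<pi> j < length C" if "j < length C" for j
    using permutes_in_image[OF \<pi>(1), of j] that by simp
  show ?thesis
    unfolding realizable_def
    using A nth lt len reindex[of "A _"] reindex[of "\<lambda>j. {#\<bar>A _ j\<bar>#}"]
    by (intro exI[of _ "\<lambda>i j. A i (\<pi> j)"]) simp
qed

lemma realizable_permute_rows:
  assumes "realizable M R C" "mset R = mset R'"
  shows "realizable M R' C"
  by (rule realizable_transpose[OF realizable_permute_cols[OF realizable_transpose[OF assms(1)] assms(2)]])

lemma realizable_permute: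
  assumes "realizable M R C" "mset R = mset R'" "mset C = mset C'"
  shows "realizable M R' C'"
  by (rule realizable_permute_cols[OF realizable_permute_rows[OF assms(1,2)] assms(3)])

lemma map2_plus_replicate_0 [simp]:
  "length xs = n \<Longrightarrow> map2 (+) xs (replicate n 0) = (xs :: int list)"
  "length xs = n \<Longrightarrow> map2 (+) (replicate n 0) xs = (xs :: int list)"
  by (auto intro: nth_equalityI)

lemma map2_plus_uminus:
  "length xs = n \<Longrightarrow> map2 (+) xs (map uminus xs) = (replicate n 0 :: int list)"
  by (auto intro: nth_equalityI)

section \<open>Multisets of consecutive integers\<close>

definition interval :: "int \<Rightarrow> nat \<Rightarrow> int multiset" where
  "interval a l = (\<Sum>i<l. {#a + 1 + int i#})"

lemma interval_0 [simp]: "interval a 0 = {#}"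
  by (simp add: interval_def)

text \<open>Since \<open>interval a l\<close> starts just above \<open>a\<close>, its right end is
  the parameter of the interval that continues it.\<close>

lemma interval_add: "interval a (l + l') = interval a l + interval (a + int l) l'"
  by (simp add: interval_def sum_lessThan_add add_ac)

lemma interval_rev: "(\<Sum>i<l. {#a + int l - int i#}) = interval a l"
proof -
  have "(\<Sum>i<l. {#a + int l - int i#}) = (\<Sum>i<l. {#a + 1 + int (l - Suc i)#})"
    by (intro sum.cong) (auto simp: of_nat_diff)
  also have "\<dots> = interval a l"
    unfolding interval_def by (rule sum.nat_diff_reindex)
  finally show ?thesis .
qed

lemma interval_alternate:
  "(\<Sum>i<q. {#a + 1 + 2 * int i#}) + (\<Sum>i<q. {#a + 2 + 2 * int i#}) = interval a (2 * q)"
  by (induction q) (simp_all add: interval_def algebra_simps)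

lemma interval_eq_mset: "interval a l = image_mset (\<lambda>x. x + a) (mset [1..int l])"
proof (induction l)
  case (Suc l)
  have "[1..int (Suc l)] = [1..int l] @ [int (Suc l)]"
    using upto_rec2[of 1 "int (Suc l)"] by simp
  with Suc show ?case by (simp add: interval_def algebra_simps)
qed (simp add: interval_def)

lemma set_interval: "set_mset (interval a l) = {a + 1..a + int l}"
proof (induction l)
  case (Suc l)
  have "{a + 1..a + int (Suc l)} = insert (a + 1 + int l) {a + 1..a + int l}" by auto
  with Suc show ?case by (simp add: interval_def)
qed (simp add: interval_def)

lemma interval_chunks: "(\<Sum>j<c. interval (a + int (j * l)) l) = interval a (c * l)"
proof (induction c)
  case (Suc c)
  have "interval a (Suc c * l) = interval a (c * l + l)" by (simp add: add.commute)
  with Suc show ?case by (simp only: sum.lessThan_Suc interval_add)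
qed simp

section \<open>Shiftable arrays and tables of small ones\<close>

definition balanced :: "int list list \<Rightarrow> int list \<Rightarrow> int list \<Rightarrow> bool" where
  "balanced X R C \<longleftrightarrow>
     list_all (\<lambda>xs. length xs = length C \<and> (\<Sum>x\<leftarrow>xs. sgn x) = 0) X \<and>
     map sum_list X = R \<and>
     map (\<lambda>j. \<Sum>xs\<leftarrow>X. xs ! j) [0..<length C] = C \<and>
     list_all (\<lambda>j. (\<Sum>xs\<leftarrow>X. sgn (xs ! j)) = 0) [0..<length C] \<and>
     sort (map abs (concat X)) = [1..int (length R * length C)]"

text \<open>Equally many signs of both kinds in every line make the line sums independent of the
  shift \<open>B\<close> of the absolute values.\<close>

lemma realizable_balanced:
  assumes bal: "balanced X R C" and B: "B \<ge> 0"
  shows "realizable (interval B (length R * length C)) R C"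
proof -
  have X: "\<And>xs. xs \<in> set X \<Longrightarrow> length xs = length C \<and> (\<Sum>x\<leftarrow>xs. sgn x) = 0"
    and R: "map sum_list X = R"
    and C: "map (\<lambda>j. \<Sum>xs\<leftarrow>X. xs ! j) [0..<length C] = C"
    and Csgn: "\<And>j. j < length C \<Longrightarrow> (\<Sum>xs\<leftarrow>X. sgn (xs ! j)) = 0"
    and sorted: "sort (map abs (concat X)) = [1..int (length R * length C)]"
    using bal unfolding balanced_def list_all_iff by simp_all
  have ms: "mset (map abs (concat X)) = mset [1..int (length R * length C)]"
    using arg_cong[OF sorted, of mset] unfolding mset_sort .
  have len: "length X = length R"
    using R by (metis length_map)
  then have lenX: "length (X ! i) = length C" if "i < length R" for i
    using X that by simp
  have sl: "sum_list xs = (\<Sum>j<length xs. xs ! j)" for xs :: "int list"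
    by (simp add: sum_list_sum_nth atLeast0LessThan)
  have row: "(\<Sum>j<length C. X ! i ! j) = R ! i" if "i < length R" for i
  proof -
    have "R ! i = sum_list (X ! i)" using R len that by (metis nth_map)
    then show ?thesis unfolding sl lenX[OF that] by simp
  qed
  have rowsgn: "(\<Sum>j<length C. sgn (X ! i ! j)) = 0" if "i < length R" for i
  proof -
    have "sum_list (map sgn (X ! i)) = 0" using X len that by simp
    then show ?thesis unfolding sl length_map lenX[OF that] by (simp add: lenX[OF that])
  qed
  have col: "(\<Sum>i<length R. X ! i ! j) = C ! j" if "j < length C" for j
  proof -
    have "C ! j = (\<Sum>xs\<leftarrow>X. xs ! j)"
      using arg_cong[OF C, of "\<lambda>xs. xs ! j"] that by simp
    then show ?thesis unfolding sl by (simp add: len)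
  qed
  have colsgn: "(\<Sum>i<length R. sgn (X ! i ! j)) = 0" if "j < length C" for j
    using Csgn[OF that] unfolding sl by (simp add: len)
  \<comment> \<open>No entry is 0, so adding \<open>B\<close> times its sign raises the absolute
    value by exactly \<open>B\<close>.\<close>
  have pos: "\<bar>X ! i ! j\<bar> \<ge> 1" if "i < length R" "j < length C" for i j
  proof -
    have "X ! i ! j \<in> set (X ! i)" "X ! i \<in> set X" using that len lenX by simp_all
    then have "X ! i ! j \<in> set (concat X)" by auto
    then have "\<bar>X ! i ! j\<bar> \<in># mset (map abs (concat X))" by auto
    then show ?thesis unfolding ms by simp
  qed
  have cont: "mset (map abs (concat X)) = (\<Sum>i<length R. \<Sum>j<length C. {#\<bar>X ! i ! j\<bar>#})"
  proof -
    have 1: "mset (map f xs) = (\<Sum>j<length xs. {#f (xs ! j)#})" for f :: "int \<Rightarrow> int" and xs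
      by (induction xs rule: rev_induct) (auto simp: nth_append)
    have 2: "mset (map f (concat Y)) = (\<Sum>i<length Y. mset (map f (Y ! i)))" for f :: "int \<Rightarrow> int" and Y
      by (induction Y rule: rev_induct) (auto simp: nth_append)
    show ?thesis unfolding 2 len using lenX 1 by (intro sum.cong) auto
  qed
  show ?thesis
    unfolding realizable_def
  proof (intro exI[of _ "\<lambda>i j. X ! i ! j + B * sgn (X ! i ! j)"] conjI allI impI)
    show "(\<Sum>i<length R. \<Sum>j<length C. {#\<bar>X ! i ! j + B * sgn (X ! i ! j)\<bar>#})
        = interval B (length R * length C)"
    proof -
      have "\<bar>X ! i ! j + B * sgn (X ! i ! j)\<bar> = \<bar>X ! i ! j\<bar> + B" if "i < length R" "j < length C" for i j
        using pos[OF that] B by (auto simp: sgn_if abs_if)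
      then have "(\<Sum>i<length R. \<Sum>j<length C. {#\<bar>X ! i ! j + B * sgn (X ! i ! j)\<bar>#})
        = (\<Sum>i<length R. \<Sum>j<length C. image_mset (\<lambda>x. x + B) {#\<bar>X ! i ! j\<bar>#})"
        by (intro sum.cong refl) auto
      also have "\<dots> = image_mset (\<lambda>x. x + B) (mset (map abs (concat X)))"
      proof -
        have "image_mset f (\<Sum>i\<in>I. g i) = (\<Sum>i\<in>I. image_mset f (g i))"
          if "finite I" for f :: "int \<Rightarrow> int" and g :: "nat \<Rightarrow> int multiset" and I
          using that by (induction I) auto
        then show ?thesis unfolding cont by simp
      qed
      finally show ?thesis unfolding ms interval_eq_mset .
    qed
  qed (use row rowsgn col colsgn in \<open>simp_all add: sum.distrib flip: sum_distrib_left\<close>)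
qed

text \<open>Up to the order of the columns only the number of column pairs with sums 1, -1 matters:
  0, 1 or 2, each without and with one such pair of rows. Being stated by lists and a sort,
  \<open>balanced\<close> is decided by evaluation.\<close>

lemma balanced_4_4:
  "balanced
     [[-6, 2, -8, 12],
      [15, -13, 7, -9],
      [-10, -5, 4, 11],
      [1, 16, -3, -14]]
     [0, 0, 0, 0] [0, 0, 0, 0]"
  "balanced
     [[-12, 15, -7, 4],
      [2, -10, 14, -6],
      [-5, -9, 1, 13],
      [16, 3, -8, -11]]
     [0, 0, 0, 0] [1, -1, 0, 0]"
  "balanced
     [[-10, 12, -16, 14],
      [9, -11, 15, -13],
      [-6, -3, 7, 2],
      [8, 1, -5, -4]]
     [0, 0, 0, 0] [1, -1, 1, -1]"
  "balanced
     [[-4, 13, -14, 6],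
      [2, -7, 5, -1],
      [-8, -15, 12, 11],
      [10, 9, -3, -16]]
     [1, -1, 0, 0] [0, 0, 0, 0]"
  "balanced
     [[-8, 7, -14, 16],
      [2, -5, 15, -13],
      [-3, -9, 11, 1],
      [10, 6, -12, -4]]
     [1, -1, 0, 0] [1, -1, 0, 0]"
  "balanced
     [[-7, 6, -2, 4],
      [-8, 12, 5, -10],
      [1, -3, 11, -9],
      [15, -16, -13, 14]]
     [1, -1, 0, 0] [1, -1, 1, -1]"
  by code_simp+

text \<open>Widths 4 and 6 together give every even width from 4 on. The number of column pairs with
  a surplus now ranges from 0 to 3.\<close>

lemma balanced_4_6:
  "balanced
     [[6, -9, 21, -13, 12, -17],
      [-1, -23, -24, 14, 18, 16],
      [15, 10, 5, -8, -19, -3],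
      [-20, 22, -2, 7, -11, 4]]
     [0, 0, 0, 0] [0, 0, 0, 0, 0, 0]"
  "balanced
     [[-11, -9, 2, 13, -19, 24],
      [4, 1, -12, -3, 18, -8],
      [22, -10, -5, 6, -20, 7],
      [-14, 17, 15, -16, 21, -23]]
     [0, 0, 0, 0] [1, -1, 0, 0, 0, 0]"
  "balanced
     [[-11, -21, 6, 7, -5, 24],
      [8, 22, -15, -1, 3, -17],
      [14, -4, -13, 12, -18, 9],
      [-10, 2, 23, -19, 20, -16]]
     [0, 0, 0, 0] [1, -1, 1, -1, 0, 0]"
  "balanced
     [[-18, -20, 17, 23, -6, 4],
      [14, 12, -24, -22, 21, -1],
      [15, -2, -8, 11, -19, 3],
      [-10, 9, 16, -13, 5, -7]]
     [0, 0, 0, 0] [1, -1, 1, -1, 1, -1]"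
  "balanced
     [[-23, 10, 20, -15, -13, 22],
      [-6, -9, -16, 5, 24, 1],
      [18, -8, -21, 12, 3, -4],
      [11, 7, 17, -2, -14, -19]]
     [1, -1, 0, 0] [0, 0, 0, 0, 0, 0]"
  "balanced
     [[13, 10, -3, -24, 17, -12],
      [14, -16, -8, 23, -18, 4],
      [-11, 7, 6, -21, 20, -1],
      [-15, -2, 5, 22, -19, 9]]
     [1, -1, 0, 0] [1, -1, 0, 0, 0, 0]"
  "balanced
     [[17, -6, 7, -15, 22, -24],
      [-1, 14, 4, -12, -16, 10],
      [-18, 11, -2, 5, 13, -9],
      [3, -20, -8, 21, -19, 23]]
     [1, -1, 0, 0] [1, -1, 1, -1, 0, 0]"
  "balanced
     [[23, 4, -21, 18, -3, -20],
      [-10, 11, 15, -24, -5, 12],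
      [-19, -14, -6, 22, 1, 16],
      [7, -2, 13, -17, 8, -9]]
     [1, -1, 0, 0] [1, -1, 1, -1, 1, -1]"
  by code_simp+

section \<open>Even by even arrays on consecutive numbers\<close>

text \<open>One flag for two neighbouring lines. Two consecutive columns of a band taken with
  opposite signs have sums 1, -1 or 0, 0, so all line sums that occur have this form.\<close>

definition pairs :: "bool list \<Rightarrow> int list" where
  "pairs ds = concat (map (\<lambda>d. if d then [1, - 1] else [0, 0]) ds)"

lemma pairs_simps [simp]:
  "pairs [] = []"
  "pairs (d # ds) = (if d then [1, - 1] else [0, 0]) @ pairs ds"
  by (simp_all add: pairs_def)

lemma pairs_append: "pairs (ds @ ds') = pairs ds @ pairs ds'"
  by (simp add: pairs_def)

lemma length_pairs [simp]: "length (pairs ds) = 2 * length ds"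
  by (induction ds) auto

lemma pairs_replicate_False [simp]: "pairs (replicate Q False) = replicate (2 * Q) 0"
  by (induction Q) auto

lemma realizable_4_4:
  assumes "B \<ge> 0"
  shows "realizable (interval B 16) (pairs [r, False]) (pairs [d1, d2])"
proof -
  note data = balanced_4_4[THEN realizable_balanced, OF assms, simplified]
  show ?thesis
    \<comment> \<open>Each choice of flags is a rearrangement of the line sums of one of the
      tables.\<close>
    by (cases r; cases d1; cases d2) (use data in \<open>auto simp: eval_nat_numeral elim: realizable_permute\<close>)
qed

lemma realizable_4_6:
  assumes "B \<ge> 0"
  shows "realizable (interval B 24) (pairs [r, False]) (pairs [d1, d2, d3])"
proof -
  note data = balanced_4_6[THEN realizable_balanced, OF assms, simplified]
  show ?thesis
    by (cases r; cases d1; cases d2; cases d3) (use data in \<open>auto simp: eval_nat_numeral elim: realizable_permute\<close>)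
qed

text \<open>Four columns are split off until 4 or 6 columns are left.\<close>

lemma realizable_4_even:
  assumes "B \<ge> 0" "length ds \<ge> 2"
  shows "realizable (interval B (8 * length ds)) (pairs [r, False]) (pairs ds)"
  using assms
proof (induction "length ds" arbitrary: ds B rule: less_induct)
  case less
  then consider d1 d2 where "ds = [d1, d2]" | d1 d2 d3 where "ds = [d1, d2, d3]"
    | d1 d2 ds' where "ds = d1 # d2 # ds'" "length ds' \<ge> 2"
    by (cases ds rule: list.exhaust; cases "tl ds"; cases "tl (tl ds)"; cases "tl (tl (tl ds))") auto
  then show ?case
  proof cases
    case 1
    then show ?thesis using realizable_4_4[OF less.prems(1)] by simp
  next
    case 2
    then show ?thesis using realizable_4_6[OF less.prems(1)] by simp
  next
    case 3
    \<comment> \<open>The four columns split off have row sums 0, so that the surplus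
      \<open>r\<close> is contributed once, by the rest.\<close>
    have "realizable (interval B 16 + interval (B + 16) (8 * length ds'))
      (map2 (+) (pairs [False, False]) (pairs [r, False])) (pairs [d1, d2] @ pairs ds')"
      using less.hyps[of ds' "B + 16"] less.prems 3
      by (intro realizable_append_cols realizable_4_4) auto
    moreover have "interval B 16 + interval (B + 16) (8 * length ds') = interval B (8 * length ds)"
      using interval_add[of B 16 "8 * length ds'"] 3 by simp
    moreover have "map2 (+) (pairs [False, False]) (pairs [r, False]) = pairs [r, False]"
      by simp
    moreover have "pairs [d1, d2] @ pairs ds' = pairs ds"
      using 3 by simp
    ultimately show ?thesis by (simp only:)
  qed
qed

text \<open>Each strip of four rows consists of two row pairs. For \<open>r = True\<close> exactly
  one of them has a surplus, so that half of all flags are set: this is the proportion that a band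
  with \<open>e = q\<close> produces.\<close>

definition strips :: "bool \<Rightarrow> nat \<Rightarrow> bool list" where
  "strips r t = concat (replicate t [r, False])"

lemma length_strips [simp]: "length (strips r t) = 2 * t"
  by (induction t) (auto simp: strips_def)

lemma realizable_region:
  assumes "B \<ge> 0" "length ds \<ge> 2" "t \<ge> 1"
  shows "realizable (interval B (8 * t * length ds)) (pairs (strips r t)) (pairs ds)"
  using assms(3)
proof (induction t rule: nat_induct_at_least)
  case base
  then show ?case using realizable_4_even[OF assms(1,2), of r] by (simp add: strips_def)
next
  case (Suc t)
  let ?Q = "length ds"
  \<comment> \<open>Only the first strip carries the column surpluses \<open>ds\<close>; every
    further strip has column sums 0.\<close>
  have "realizable (interval (B + int (8 * t * ?Q)) (8 * ?Q) + interval B (8 * t * ?Q))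
     (pairs [r, False] @ pairs (strips r t))
     (map2 (+) (pairs (replicate ?Q False)) (pairs ds))"
    using assms Suc.IH realizable_4_even[of "B + int (8 * t * ?Q)" "replicate ?Q False" r]
    by (intro realizable_append_rows) auto
  moreover have "interval (B + int (8 * t * ?Q)) (8 * ?Q) + interval B (8 * t * ?Q)
      = interval B (8 * Suc t * ?Q)"
    using interval_add[of B "8 * t * ?Q" "8 * ?Q"] by (simp add: algebra_simps)
  moreover have "pairs [r, False] @ pairs (strips r t) = pairs (strips r (Suc t))"
    by (simp add: strips_def flip: pairs_append)
  ultimately show ?case by simp
qed

section \<open>Bands of three rows\<close>

text \<open>Column number \<open>i\<close> has x = \<open>p + 2 i\<close>, y = \<open>u - i\<close>,
  z = \<open>w + i\<close>. Both x and z - y grow by 2 with each step, so x + y - z does not depend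
  on \<open>i\<close>.\<close>

definition triple :: "int \<Rightarrow> int \<Rightarrow> int \<Rightarrow> nat \<Rightarrow> int multiset" where
  "triple p u w i = {#\<bar>p + 2 * int i\<bar>, \<bar>u - int i\<bar>, \<bar>w + int i\<bar>#}"

lemma realizable_column: "realizable {#\<bar>a\<bar>, \<bar>b\<bar>, \<bar>c\<bar>#} [a, b, c] [a + b + c]"
  unfolding realizable_def
  by (intro exI[of _ "\<lambda>i j. [a, b, c] ! i"]) (auto simp: less_Suc_eq numeral_3_eq_3)

lemma realizable_triple:
  "realizable (triple p u w i) [p + 2 * int i, u - int i, - (w + int i)]
    [p + 2 * int i + (u - int i) + - (w + int i)]"
  using realizable_column[of "p + 2 * int i" "u - int i" "- (w + int i)"]
  by (simp only: triple_def abs_minus_cancel)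

definition unit_vecs :: "int list set" where
  "unit_vecs = {[- 2, 1, 1], [1, - 2, 1], [1, 1, - 2], [2, - 1, - 1], [- 1, 2, - 1], [- 1, - 1, 2]}"

text \<open>In the difference of two consecutive columns x contributes -2 while y and -z contribute
  1 each. Negation and row permutations reach the other elements of
  \<open>unit_vecs\<close>.\<close>

lemma realizable_pair:
  assumes "p + u = w + of_bool d" "v \<in> unit_vecs"
  shows "realizable (triple p u w i + triple p u w (Suc i)) v (pairs [d])"
proof -
  have "realizable (triple p u w i + triple p u w (Suc i))
      (map2 (+) [p + 2 * int i, u - int i, - (w + int i)]
        (map uminus [p + 2 * int (Suc i), u - int (Suc i), - (w + int (Suc i))]))
      ([p + 2 * int i + (u - int i) + - (w + int i)] @
        map uminus [p + 2 * int (Suc i) + (u - int (Suc i)) + - (w + int (Suc i))])"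
    by (intro realizable_append_cols realizable_uminus realizable_triple) simp
  then have *: "realizable (triple p u w i + triple p u w (Suc i)) [- 2, 1, 1] (pairs [d])"
    using assms(1) by (cases d) (simp_all add: algebra_simps)
  \<comment> \<open>Negation turns the column sums 1, -1 into -1, 1; swapping the two columns
    restores them.\<close>
  then have "realizable (triple p u w i + triple p u w (Suc i)) [2, - 1, - 1] (map uminus (pairs [d]))"
    using realizable_uminus by fastforce
  then have **: "realizable (triple p u w i + triple p u w (Suc i)) [2, - 1, - 1] (pairs [d])"
    by (rule realizable_permute_cols) auto
  show ?thesis
    using assms(2) realizable_permute_rows[OF *] realizable_permute_rows[OF **]
    by (auto simp: unit_vecs_def)
qed

text \<open>The three columns are rotated against each other, so that every row meets each of the three
  arithmetic progressions once.\<close>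

lemma realizable_rotated:
  assumes "p + u = w"
  shows "realizable (triple p u w i + (triple p u w (i + 1) + triple p u w (i + 2)))
    [- 3, 0, 3] [0, 0, 0]"
proof -
  let ?x = "\<lambda>i. p + 2 * int i" and ?y = "\<lambda>i. u - int i" and ?z = "\<lambda>i. - (w + int i)"
  have "realizable (triple p u w i + (triple p u w (i + 1) + triple p u w (i + 2)))
      (map2 (+) [?x i, ?y i, ?z i]
        (map2 (+) [?z (i + 1), ?x (i + 1), ?y (i + 1)] [?y (i + 2), ?z (i + 2), ?x (i + 2)]))
      ([?x i + ?y i + ?z i] @
        [?z (i + 1) + ?x (i + 1) + ?y (i + 1)] @ [?y (i + 2) + ?z (i + 2) + ?x (i + 2)])"
  proof (intro realizable_append_cols)
    show "realizable (triple p u w i) [?x i, ?y i, ?z i] [?x i + ?y i + ?z i]"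
      by (rule realizable_triple)
  next
    show "realizable (triple p u w (i + 1)) [?z (i + 1), ?x (i + 1), ?y (i + 1)]
        [?z (i + 1) + ?x (i + 1) + ?y (i + 1)]"
      using realizable_column[of "?z (i + 1)" "?x (i + 1)" "?y (i + 1)"]
      by (simp only: triple_def abs_minus_cancel add_mset_commute)
  next
    show "realizable (triple p u w (i + 2)) [?y (i + 2), ?z (i + 2), ?x (i + 2)]
        [?y (i + 2) + ?z (i + 2) + ?x (i + 2)]"
      using realizable_column[of "?y (i + 2)" "?z (i + 2)" "?x (i + 2)"]
      by (simp only: triple_def abs_minus_cancel add_mset_commute)
  qed auto
  \<comment> \<open>Each row contains one x, one y and one -z, so the terms in \<open>i\<close> and
    the starting values cancel; the different offsets leave -3, 0, 3.\<close>
  then show ?thesis unfolding assms[symmetric] by (simp add: algebra_simps)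
qed

text \<open>Two opposite vectors can be added at will, so \<open>n = 2\<close> and
  \<open>n = 3\<close> suffice. The sum (3, 0, -3) is there to cancel the row sums of three rotated
  columns.\<close>

lemma unit_vecs_sum:
  assumes "n \<ge> 2" "t \<in> {[0, 0, 0], [3, 0, - 3]}"
  shows "\<exists>vs. length vs = n \<and> set vs \<subseteq> unit_vecs \<and> foldr (map2 (+)) vs [0, 0, 0] = t"
  using assms(1)
proof (induction n rule: less_induct)
  case (less n)
  consider "n = 2" | "n = 3" | "n - 2 \<ge> 2" using less.prems by linarith
  then show ?case
  proof cases
    case 1
    then show ?thesis
      using assms(2)
      by (intro exI[of _ "if t = [0, 0, 0] then [[2, - 1, - 1], [- 2, 1, 1]] else [[2, - 1, - 1], [1, 1, - 2]]"])
         (auto simp: unit_vecs_def)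
  next
    case 2
    then show ?thesis
      using assms(2)
      by (intro exI[of _ "if t = [0, 0, 0] then [[2, - 1, - 1], [- 1, 2, - 1], [- 1, - 1, 2]]
          else [[2, - 1, - 1], [2, - 1, - 1], [- 1, 2, - 1]]"])
         (auto simp: unit_vecs_def)
  next
    case 3
    then obtain vs where "length vs = n - 2" "set vs \<subseteq> unit_vecs" "foldr (map2 (+)) vs [0, 0, 0] = t"
      using less.IH[of "n - 2"] less.prems by auto
    then show ?thesis
      using 3 less.prems assms(2)
      by (intro exI[of _ "[2, - 1, - 1] # [- 2, 1, 1] # vs"]) (auto simp: unit_vecs_def)
  qed
qed

definition segment :: "(nat \<Rightarrow> 'a::comm_monoid_add) \<Rightarrow> nat \<Rightarrow> nat \<Rightarrow> 'a" where
  "segment f s l = (\<Sum>i<l. f (s + i))"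

lemma segment_0 [simp]: "segment f s 0 = 0"
  by (simp add: segment_def)

lemma segment_add: "segment f s (l + l') = segment f s l + segment f (s + l) l'"
  by (simp add: segment_def sum_lessThan_add add.assoc)

lemma segment_2: "segment f s 2 = f s + f (Suc s)"
  by (simp add: segment_def numeral_2_eq_2)

lemma segment_3: "segment f s 3 = f s + (f (s + 1) + f (s + 2))"
  by (simp add: segment_def numeral_3_eq_3 add.assoc)

text \<open>Lets \<open>c\<close> arrays share one progression of triples: each takes up where the
  previous ones stopped.\<close>

lemma segment_consecutive:
  fixes g :: "nat \<Rightarrow> nat"
  shows "(\<Sum>j<c. segment f (\<Sum>i<j. g i) (g j)) = segment f 0 (\<Sum>j<c. g j)"
  by (induction c) (simp_all add: segment_add)

context
  fixes p u w p' u' w' :: int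
  assumes exact: "p + u = w" and excess: "p' + u' = w' + 1"
begin

text \<open>Unset flags consume triples with x + y = z, set flags those with x + y = z + 1. The
  vector \<open>v\<close> of each pair can be chosen independently of its flag, so the row sums can
  be steered without touching the column sums.\<close>

lemma realizable_pairs:
  assumes "length vs = length ds" "set vs \<subseteq> unit_vecs"
  shows "realizable
    (segment (triple p u w) s (2 * count_list ds False) + segment (triple p' u' w') s' (2 * count_list ds True))
    (foldr (map2 (+)) vs [0, 0, 0]) (pairs ds)"
  using assms
proof (induction vs ds arbitrary: s s' rule: list_induct2)
  case Nil
  show ?case by (auto simp: realizable_def less_Suc_eq numeral_3_eq_3 intro: exI[of _ "\<lambda>_ _. 0"])
next
  case (Cons v vs d ds)
  have len: "length (foldr (map2 (+)) ws [0, 0, 0 :: int]) = 3" if "set ws \<subseteq> unit_vecs" for ws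
    using that by (induction ws) (auto simp: unit_vecs_def)
  have v: "v \<in> unit_vecs" "length v = 3" and vs: "set vs \<subseteq> unit_vecs"
    using Cons.prems by (auto simp: unit_vecs_def)
  let ?t = "foldr (map2 (+)) vs [0, 0, 0]"
  show ?case
  proof (cases d)
    case True
    have "realizable (segment (triple p' u' w') s' 2 +
       (segment (triple p u w) s (2 * count_list ds False)
        + segment (triple p' u' w') (s' + 2) (2 * count_list ds True)))
       (map2 (+) v ?t) (pairs [d] @ pairs ds)"
      unfolding segment_2 using Cons.IH vs v excess True len[OF vs]
      by (intro realizable_append_cols realizable_pair) auto
    then show ?thesis
      using True segment_add[of "triple p' u' w'" s' 2 "2 * count_list ds True"]
      by (simp add: ac_simps)
  next
    case False
    have "realizable (segment (triple p u w) s 2 +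
       (segment (triple p u w) (s + 2) (2 * count_list ds False)
        + segment (triple p' u' w') s' (2 * count_list ds True)))
       (map2 (+) v ?t) (pairs [d] @ pairs ds)"
      unfolding segment_2 using Cons.IH vs v exact False len[OF vs]
      by (intro realizable_append_cols realizable_pair) auto
    then show ?thesis
      using False segment_add[of "triple p u w" s 2 "2 * count_list ds False"]
      by (simp add: ac_simps)
  qed
qed

text \<open>For even width the pairs are chosen with row sums adding up to 0, for odd width to (3,
  0, -3), which cancels the three rotated columns in front of them.\<close>

lemma realizable_three_rows:
  assumes "length ds \<ge> 2"
  shows "realizable
    (segment (triple p u w) s (3 * of_bool z + 2 * count_list ds False)
      + segment (triple p' u' w') s' (2 * count_list ds True))
    [0, 0, 0] (replicate (3 * of_bool z) 0 @ pairs ds)"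
proof (cases z)
  case False
  with unit_vecs_sum[OF assms, of "[0, 0, 0]"] realizable_pairs show ?thesis by fastforce
next
  case True
  from unit_vecs_sum[OF assms, of "[3, 0, - 3]"] obtain vs where
    "length vs = length ds" "set vs \<subseteq> unit_vecs" "foldr (map2 (+)) vs [0, 0, 0] = [3, 0, - 3]"
    by auto
  with realizable_pairs[of vs ds] have "realizable
    (segment (triple p u w) (s + 3) (2 * count_list ds False) + segment (triple p' u' w') s' (2 * count_list ds True))
    [3, 0, - 3] (pairs ds)" by metis
  then have "realizable (segment (triple p u w) s 3 +
     (segment (triple p u w) (s + 3) (2 * count_list ds False) + segment (triple p' u' w') s' (2 * count_list ds True)))
    (map2 (+) [- 3, 0, 3] [3, 0, - 3]) ([0, 0, 0] @ pairs ds)"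
    unfolding segment_3 by (intro realizable_append_cols realizable_rotated exact) auto
  then show ?thesis
    using True segment_add[of "triple p u w" s 3 "2 * count_list ds False"]
    by (simp add: numeral_3_eq_3 add.assoc)
qed

end

text \<open>The upper bands of \<open>c\<close> arrays, with \<open>e + q\<close> columns of triples \<open>x + y = z\<close> or
  \<open>x + y = z + 1\<close> in total. The differences \<open>z - y\<close> are consecutive odd numbers shifted by \<open>\<alpha>\<close>,
  so the two nested families of pairs \<open>(y, z)\<close> may be put anywhere, provided that the innermost
  pair leaves a gap of length \<open>\<alpha>\<close>.\<close>

definition bands :: "nat \<Rightarrow> (nat \<Rightarrow> int list) \<Rightarrow> nat \<Rightarrow> nat \<Rightarrow> nat \<Rightarrow> bool" where
  "bands p C c e q \<longleftrightarrow> (\<forall>\<alpha>\<ge>0. \<forall>\<beta>\<ge>0. \<forall>\<beta>'\<ge>0. \<exists>T.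
     (\<forall>j<c. realizable (T j) (replicate p 0) (C j)) \<and>
     (\<Sum>j<c. T j) = interval \<alpha> (e + q)
       + (interval \<beta> e + interval (\<beta> + int e + \<alpha>) e)
       + (interval \<beta>' q + interval (\<beta>' + int q + \<alpha>) q))"

text \<open>The exact triples take the odd positions of the interval above \<alpha> as their x,
  those with excess the even positions; hence \<open>e = q\<close> or \<open>e = Suc q\<close>. In
  each family y runs down and z up from the two ends of a gap of length \<alpha>.\<close>

lemma segment_triple_union:
  fixes \<alpha> \<beta> \<beta>' :: int
  assumes "\<alpha> \<ge> 0" "\<beta> \<ge> 0" "\<beta>' \<ge> 0" "e = q \<or> e = Suc q"
  shows "segment (triple (\<alpha> + 1) (\<beta> + int e) (\<beta> + int e + \<alpha> + 1)) 0 e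
      + segment (triple (\<alpha> + 2) (\<beta>' + int q) (\<beta>' + int q + \<alpha> + 1)) 0 q
    = interval \<alpha> (e + q)
       + (interval \<beta> e + interval (\<beta> + int e + \<alpha>) e)
       + (interval \<beta>' q + interval (\<beta>' + int q + \<alpha>) q)"
proof -
  have seg: "segment (triple a (b + int l) (d + 1)) 0 l
      = (\<Sum>i<l. {#a + 2 * int i#}) + (interval b l + interval d l)"
    if "a \<ge> 0" "b \<ge> 0" "d \<ge> 0" for a b d :: int and l
  proof -
    have "segment (triple a (b + int l) (d + 1)) 0 l
      = (\<Sum>i<l. {#a + 2 * int i#} + ({#b + int l - int i#} + {#d + 1 + int i#}))"
      unfolding segment_def triple_def using that by (intro sum.cong) auto
    then show ?thesis by (simp only: sum.distrib interval_rev interval_def)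
  qed
  have x: "(\<Sum>i<e. {#\<alpha> + 1 + 2 * int i#}) + (\<Sum>i<q. {#\<alpha> + 2 + 2 * int i#}) = interval \<alpha> (e + q)"
  proof (cases "e = q")
    case True
    show ?thesis unfolding True using interval_alternate[of \<alpha> q] unfolding mult_2 .
  next
    case False
    then have e: "e = Suc q" using assms(4) by simp
    \<comment> \<open>The exact triple in excess takes the last, odd position.\<close>
    have "interval \<alpha> (e + q) = interval \<alpha> (2 * q) + {#\<alpha> + 1 + 2 * int q#}"
    proof -
      have "e + q = 2 * q + 1" "interval (\<alpha> + int (2 * q)) 1 = {#\<alpha> + 1 + 2 * int q#}"
        using e by (simp_all add: interval_def)
      then show ?thesis by (simp only: interval_add)
    qed
    then show ?thesis
      unfolding interval_alternate[symmetric] e sum.lessThan_Suc by (simp only: ac_simps)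
  qed
  show ?thesis
    using assms seg[of "\<alpha> + 1" \<beta> "\<beta> + int e + \<alpha>" e] seg[of "\<alpha> + 2" \<beta>' "\<beta>' + int q + \<alpha>" q]
    unfolding x[symmetric] by (simp add: ac_simps)
qed

lemma bands_3:
  fixes D :: "nat \<Rightarrow> bool list"
  assumes "\<And>j. j < c \<Longrightarrow> length (D j) \<ge> 2"
    and e: "e = (\<Sum>j<c. 3 * of_bool z + 2 * count_list (D j) False)"
    and q: "q = (\<Sum>j<c. 2 * count_list (D j) True)"
    and eq: "e = q \<or> e = Suc q"
  shows "bands 3 (\<lambda>j. replicate (3 * of_bool z) 0 @ pairs (D j)) c e q"
  unfolding bands_def
proof (intro allI impI)
  fix \<alpha> \<beta> \<beta>' :: int
  assume nonneg: "\<alpha> \<ge> 0" "\<beta> \<ge> 0" "\<beta>' \<ge> 0"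
  \<comment> \<open>The largest y is \<beta> + \<open>e\<close> and the smallest z lies \<alpha> + 1
    above it. So x = \<alpha> + 1 makes a triple exact, and x = \<alpha> + 2, used in
    \<open>?O\<close>, gives the excess 1.\<close>
  let ?E = "triple (\<alpha> + 1) (\<beta> + int e) (\<beta> + int e + \<alpha> + 1)"
  let ?O = "triple (\<alpha> + 2) (\<beta>' + int q) (\<beta>' + int q + \<alpha> + 1)"
  let ?g = "\<lambda>j. 3 * of_bool z + 2 * count_list (D j) False"
  let ?h = "\<lambda>j. 2 * count_list (D j) True"
  let ?T = "\<lambda>j. segment ?E (\<Sum>i<j. ?g i) (?g j) + segment ?O (\<Sum>i<j. ?h i) (?h j)"
  have "realizable (?T j) (replicate 3 0) (replicate (3 * of_bool z) 0 @ pairs (D j))" if "j < c" for j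
  proof -
    have "replicate 3 0 = [0, 0, 0 :: int]" by (simp add: numeral_3_eq_3)
    then show ?thesis using assms(1)[OF that] by (simp only:) (intro realizable_three_rows, auto)
  qed
  moreover have "(\<Sum>j<c. ?T j) = interval \<alpha> (e + q)
       + (interval \<beta> e + interval (\<beta> + int e + \<alpha>) e)
       + (interval \<beta>' q + interval (\<beta>' + int q + \<alpha>) q)"
  proof -
    have "(\<Sum>j<c. ?T j) = (\<Sum>j<c. segment ?E (\<Sum>i<j. ?g i) (?g j)) + (\<Sum>j<c. segment ?O (\<Sum>i<j. ?h i) (?h j))"
      by (rule sum.distrib)
    also have "\<dots> = segment ?E 0 e + segment ?O 0 q"
      unfolding segment_consecutive e[symmetric] q[symmetric] ..
    finally show ?thesis unfolding segment_triple_union[OF nonneg eq] .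
  qed
  ultimately show "\<exists>T. (\<forall>j<c. realizable (T j) (replicate 3 0) (replicate (3 * of_bool z) 0 @ pairs (D j))) \<and>
     (\<Sum>j<c. T j) = interval \<alpha> (e + q)
       + (interval \<beta> e + interval (\<beta> + int e + \<alpha>) e)
       + (interval \<beta>' q + interval (\<beta>' + int q + \<alpha>) q)" by (intro exI[of _ ?T]) blast
qed

section \<open>Distributing the surplus pairs, and cancelling them in stacks of three bands\<close>

lemma bounded_summands:
  fixes cap :: "nat \<Rightarrow> nat"
  assumes "S \<le> (\<Sum>j<c. cap j)"
  shows "\<exists>f. (\<forall>j<c. f j \<le> cap j) \<and> (\<Sum>j<c. f j) = S"
  using assms
proof (induction c arbitrary: S)
  case (Suc c)
  have "S - min S (cap c) \<le> (\<Sum>j<c. cap j)" using Suc.prems by auto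
  with Suc.IH obtain f where f: "\<forall>j<c. f j \<le> cap j" "(\<Sum>j<c. f j) = S - min S (cap c)" by blast
  have "(\<Sum>j<c. (f(c := min S (cap c))) j) = (\<Sum>j<c. f j)" by (intro sum.cong) auto
  then show ?case
    using f by (intro exI[of _ "f(c := min S (cap c))"]) (auto simp: less_Suc_eq)
qed simp

lemma count_list_replicate: "count_list (replicate n x) y = (if x = y then n else 0)"
  by (induction n) auto

definition marks :: "nat \<Rightarrow> nat \<Rightarrow> bool list" where
  "marks Q f = replicate f True @ replicate (Q - f) False"

lemma length_marks [simp]: "f \<le> Q \<Longrightarrow> length (marks Q f) = Q"
  by (simp add: marks_def)

lemma count_marks [simp]:
  "count_list (marks Q f) True = f"
  "count_list (marks Q f) False = Q - f"
  by (simp_all add: marks_def count_list_replicate count_list_append)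

lemma mset_pairs_marks:
  "f \<le> Q \<Longrightarrow> mset (pairs (marks Q f))
    = replicate_mset f 1 + replicate_mset f (- 1) + replicate_mset (2 * Q - 2 * f) 0"
proof -
  have "mset (pairs (replicate n True)) = replicate_mset n 1 + replicate_mset n (- 1)" for n
    by (induction n) auto
  then show ?thesis by (simp add: marks_def pairs_append diff_mult_distrib2)
qed

text \<open>Among the \<open>b c\<close> columns those with excess must be half, rounded down, and
  they come in pairs. With \<open>S = b c div 4\<close> pairs, \<open>q = 2 S\<close> and
  \<open>e = b c - 2 S\<close> differ by \<open>b c mod 4\<close>, which has to be 0 or 1.\<close>

lemma bands_3_exists:
  assumes "Q \<ge> 2" "b = 3 * of_bool z + 2 * Q" "b * c mod 4 \<le> 1" "c \<ge> 1"
  shows "\<exists>D e q. (\<forall>j. j < c \<longrightarrow> length (D j) = Q) \<and> e + q = b * c \<and>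
    bands 3 (\<lambda>j. replicate (3 * of_bool z) 0 @ pairs (D j)) c e q"
proof -
  define S where "S = b * c div 4"
  \<comment> \<open>This bound guarantees that the \<open>c\<close> arrays have room for
    \<open>S\<close> pairs, at most \<open>Q\<close> in each.\<close>
  have "b \<le> 4 * Q" using assms(1,2) by (cases z) auto
  then have "b * c \<le> 4 * (Q * c)" using mult_le_mono1[of b "4 * Q" c] by simp
  then have SQ: "S \<le> Q * c" unfolding S_def by linarith
  then have "S \<le> (\<Sum>j<c. Q)" by (simp add: mult.commute)
  then obtain f where f: "\<And>j. j < c \<Longrightarrow> f j \<le> Q" "(\<Sum>j<c. f j) = S"
    using bounded_summands by blast
  have S: "4 * S \<le> b * c" "b * c \<le> 4 * S + 1" using assms(3) div_mult_mod_eq[of "b * c" 4] unfolding S_def by linarith+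
  have "(\<Sum>j<c. Q - f j) = Q * c - S"
    using f sum_subtractf_nat[of "{..<c}" f "\<lambda>_. Q"] by (simp add: mult.commute)
  then have e: "(\<Sum>j<c. 3 * of_bool z + 2 * count_list (marks Q (f j)) False)
      = b * c - 2 * S"
    by (simp add: sum.distrib flip: sum_distrib_left)
       (use assms(2) SQ in \<open>simp add: algebra_simps diff_mult_distrib2\<close>)
  have q: "(\<Sum>j<c. 2 * count_list (marks Q (f j)) True) = 2 * S"
    using f(2) by (simp flip: sum_distrib_left)
  have "bands 3 (\<lambda>j. replicate (3 * of_bool z) 0 @ pairs (marks Q (f j))) c (b * c - 2 * S) (2 * S)"
    using assms(1) f(1) e q S by (intro bands_3) auto
  then show ?thesis
    using f(1) S by (intro exI[of _ "\<lambda>j. marks Q (f j)"] exI conjI) auto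
qed

text \<open>Surpluses cancel in two ways. One pair from each band, rotated, cancel on three common
  columns; this happens \<open>f\<close> times. A pair of the first band and a pair of the second
  meet with opposite signs on two columns; this happens \<open>x\<close> times.\<close>

lemma stack_three:
  assumes "b = 3 * of_bool z + 2 * Q" "f + x \<le> Q" "3 * f + 2 * x \<le> b"
    and T: "realizable T1 (replicate 3 0) (replicate (3 * of_bool z) 0 @ pairs (marks Q (f + x)))"
      "realizable T2 (replicate 3 0) (replicate (3 * of_bool z) 0 @ pairs (marks Q (f + x)))"
      "realizable T3 (replicate 3 0) (replicate (3 * of_bool z) 0 @ pairs (marks Q f))"
  shows "realizable (T1 + (T2 + T3)) (replicate 9 0) (replicate b 0)"
proof -
  define r where "r = b - (3 * f + 2 * x)"
  let ?w1 = "replicate f 1 @ replicate f (- 1) @ replicate f 0 @ replicate x 1 @ replicate x (- 1) @ replicate r (0 :: int)"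
  let ?w2 = "replicate f 0 @ replicate f 1 @ replicate f (- 1) @ replicate x (- 1) @ replicate x 1 @ replicate r (0 :: int)"
  let ?w3 = "replicate f (- 1) @ replicate f 0 @ replicate f 1 @ replicate x 0 @ replicate x 0 @ replicate r (0 :: int)"
  \<comment> \<open>The columns of sum 0 in each band, the rotated ones included, are as many as the
    zeros in its pattern.\<close>
  have zeros: "3 * of_bool z + (2 * Q - 2 * (f + x)) = f + r" "3 * of_bool z + (2 * Q - 2 * f) = f + (x + (x + r))"
    using assms(1-3) unfolding r_def by auto
  have rep: "replicate_mset (k + l) a = replicate_mset k a + replicate_mset l a" for k l and a :: int
    by (simp add: multiset_eq_iff)
  have m: "mset (replicate (3 * of_bool z) 0 @ pairs (marks Q g))
      = replicate_mset g 1 + replicate_mset g (- 1) + replicate_mset (3 * of_bool z + (2 * Q - 2 * g)) 0"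
    if "g \<le> Q" for g
    using mset_pairs_marks[OF that] by (simp only: mset_append mset_replicate rep add_ac)
  have "realizable (T1 + (T2 + T3)) (replicate 3 0 @ (replicate 3 0 @ replicate 3 0))
     (map2 (+) ?w1 (map2 (+) ?w2 ?w3))"
  proof (intro realizable_append_rows)
    show "realizable T1 (replicate 3 0) ?w1"
      using T(1) by (rule realizable_permute_cols) (subst m[OF assms(2)], simp only: zeros mset_append mset_replicate rep add_ac)
    show "realizable T2 (replicate 3 0) ?w2"
      using T(2) by (rule realizable_permute_cols) (subst m[OF assms(2)], simp only: zeros mset_append mset_replicate rep add_ac)
    have "f \<le> Q" using assms(2) by simp
    show "realizable T3 (replicate 3 0) ?w3"
      using T(3) by (rule realizable_permute_cols)
        (subst m[OF \<open>f \<le> Q\<close>], simp only: zeros mset_append mset_replicate rep add_ac)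
  qed auto
  moreover have "map2 (+) ?w1 (map2 (+) ?w2 ?w3) = replicate b 0"
  proof -
    have "b = f + f + f + x + x + r" using assms(3) unfolding r_def by simp
    then show ?thesis by (simp add: zip_replicate replicate_add)
  qed
  ultimately show ?thesis by (simp add: replicate_add[symmetric])
qed

lemma sum_lessThan_mult_3:
  fixes F :: "nat \<Rightarrow> 'a::comm_monoid_add"
  shows "(\<Sum>l<3 * c. F l) = (\<Sum>j<c. F (3 * j) + (F (3 * j + 1) + F (3 * j + 2)))"
  by (induction c) (simp_all add: numeral_3_eq_3 add_ac)

text \<open>\<open>bands_3\<close> is applied to \<open>3 c\<close> bands, and bands
  \<open>3 j\<close>, \<open>3 j + 1\<close>, \<open>3 j + 2\<close> are stacked to array
  \<open>j\<close>. They contain \<open>f j + x j\<close>, \<open>f j + x j\<close> and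
  \<open>f j\<close> surplus pairs, hence the summand \<open>3 f + 2 x\<close> of
  \<open>S\<close>.\<close>

lemma bands_9:
  assumes "Q \<ge> 2" "b = 3 * of_bool z + 2 * Q"
    and f: "\<And>j. j < c \<Longrightarrow> f j + x j \<le> Q" "\<And>j. j < c \<Longrightarrow> 3 * f j + 2 * x j \<le> b"
    and S: "S = (\<Sum>j<c. 3 * f j + 2 * x j)" "3 * b * c = 4 * S \<or> 3 * b * c = 4 * S + 1"
  shows "\<exists>e q. e + q = 3 * b * c \<and> bands 9 (\<lambda>j. replicate b 0) c e q"
proof -
  define g where "g l = f (l div 3) + (if l mod 3 < 2 then x (l div 3) else 0)" for l
  have g3: "g (3 * j) = f j + x j" "g (3 * j + 1) = f j + x j" "g (3 * j + 2) = f j" for j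
  proof -
    have "(3 * j + 1) div 3 = j" "(3 * j + 1) mod 3 = 1" "(3 * j + 2) div 3 = j" "(3 * j + 2) mod 3 = 2"
      by presburger+
    then show "g (3 * j) = f j + x j" "g (3 * j + 1) = f j + x j" "g (3 * j + 2) = f j"
      by (simp_all only: g_def) simp_all
  qed
  have gQ: "g l \<le> Q" if "l < 3 * c" for l
  proof -
    have "l div 3 < c" using that by linarith
    from f(1)[OF this] show ?thesis unfolding g_def by auto
  qed
  have sum_g: "(\<Sum>l<3 * c. g l) = S"
    unfolding sum_lessThan_mult_3 g3 S(1) by (intro sum.cong) auto
  have SQ: "S \<le> 3 * c * Q"
    using sum_mono[of "{..<3 * c}" g "\<lambda>_. Q"] gQ sum_g by simp
  have "(\<Sum>l<3 * c. Q - g l) = 3 * c * Q - S"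
    using gQ sum_g sum_subtractf_nat[of "{..<3 * c}" g "\<lambda>_. Q"] by simp
  then have e: "(\<Sum>l<3 * c. 3 * of_bool z + 2 * count_list (marks Q (g l)) False) = 3 * b * c - 2 * S"
    by (simp add: sum.distrib flip: sum_distrib_left)
       (use assms(2) SQ in \<open>simp add: algebra_simps diff_mult_distrib2\<close>)
  have q: "(\<Sum>l<3 * c. 2 * count_list (marks Q (g l)) True) = 2 * S"
    using sum_g by (simp flip: sum_distrib_left)
  have b3: "bands 3 (\<lambda>l. replicate (3 * of_bool z) 0 @ pairs (marks Q (g l))) (3 * c) (3 * b * c - 2 * S) (2 * S)"
    using assms(1) gQ e q S(2) by (intro bands_3) auto
  have "bands 9 (\<lambda>j. replicate b 0) c (3 * b * c - 2 * S) (2 * S)"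
    unfolding bands_def
  proof (intro allI impI)
    fix \<alpha> \<beta> \<beta>' :: int
    assume "\<alpha> \<ge> 0" "\<beta> \<ge> 0" "\<beta>' \<ge> 0"
    with b3 obtain T where
      T: "\<And>l. l < 3 * c \<Longrightarrow>
        realizable (T l) (replicate 3 0) (replicate (3 * of_bool z) 0 @ pairs (marks Q (g l)))"
      and sum_T: "(\<Sum>l<3 * c. T l) = interval \<alpha> (3 * b * c - 2 * S + 2 * S)
       + (interval \<beta> (3 * b * c - 2 * S) + interval (\<beta> + int (3 * b * c - 2 * S) + \<alpha>) (3 * b * c - 2 * S))
       + (interval \<beta>' (2 * S) + interval (\<beta>' + int (2 * S) + \<alpha>) (2 * S))"
      unfolding bands_def by meson
    have "realizable (T (3 * j) + (T (3 * j + 1) + T (3 * j + 2))) (replicate 9 0) (replicate b 0)"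
      if "j < c" for j
      using T[of "3 * j"] T[of "3 * j + 1"] T[of "3 * j + 2"] that f
      unfolding g3 by (intro stack_three[OF assms(2), where f = "f j" and x = "x j"]) auto
    with sum_T show "\<exists>T. (\<forall>j<c. realizable (T j) (replicate 9 0) (replicate b 0)) \<and> (\<Sum>j<c. T j) =
        interval \<alpha> (3 * b * c - 2 * S + 2 * S)
       + (interval \<beta> (3 * b * c - 2 * S) + interval (\<beta> + int (3 * b * c - 2 * S) + \<alpha>) (3 * b * c - 2 * S))
       + (interval \<beta>' (2 * S) + interval (\<beta>' + int (2 * S) + \<alpha>) (2 * S))"
      unfolding sum_lessThan_mult_3
      by (intro exI[of _ "\<lambda>j. T (3 * j) + (T (3 * j + 1) + T (3 * j + 2))"]) blast
  qed
  moreover have "3 * b * c - 2 * S + 2 * S = 3 * b * c" using S(2) by auto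
  ultimately show ?thesis by blast
qed

text \<open>The residues 0 and 3 of \<open>b c\<close> are those for which \<open>3 b c\<close> is 0
  or 1 modulo 4. For residue 0 rotated triples of pairs suffice; for residue 3 one cancellation of
  two pairs is added.\<close>

lemma bands_9_exists:
  assumes "Q \<ge> 2" "b = 3 * of_bool z + 2 * Q" "b * c mod 4 = 0 \<or> b * c mod 4 = 3"
  shows "\<exists>e q. e + q = 3 * b * c \<and> bands 9 (\<lambda>j. replicate b 0) c e q"
proof (cases "b * c mod 4 = 0")
  case True
  define S where "S = b * c div 4"
  have S: "b * c = 4 * S" using True unfolding S_def by auto
  have "b = 2 * Q \<or> b = 3 + 2 * Q" using assms(2) by (cases z) auto
  then have "b \<le> 4 * (b div 3)"
  proof
    assume b: "b = 2 * Q"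
    have "b \<le> 3 * (b div 3) + 2" by linarith
    then have "Q \<le> 2 * (b div 3)" using b assms(1) by linarith
    then show ?thesis using b by linarith
  next
    assume b: "b = 3 + 2 * Q"
    have "b \<le> 3 * (b div 3) + 2" by linarith
    then show ?thesis using b assms(1) by linarith
  qed
  then have "b * c \<le> 4 * (b div 3) * c" by (rule mult_le_mono1)
  then have "S \<le> (\<Sum>j<c. b div 3)" using S by (simp add: mult.commute)
  then obtain f where f: "\<And>j. j < c \<Longrightarrow> f j \<le> b div 3" "(\<Sum>j<c. f j) = S"
    using bounded_summands by blast
  have "b div 3 \<le> Q" using assms(1,2) by (cases z) auto
  show ?thesis
  proof (rule bands_9[where f = f and x = "\<lambda>_. 0" and S = "3 * S", OF assms(1,2)])
    fix j assume "j < c"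
    then have "f j \<le> b div 3" by (rule f)
    with \<open>b div 3 \<le> Q\<close> show "f j + 0 \<le> Q" "3 * f j + 2 * 0 \<le> b" by linarith+
  next
    show "3 * S = (\<Sum>j<c. 3 * f j + 2 * 0)" using f(2) by (simp flip: sum_distrib_left)
  qed (use S in \<open>simp add: mult.assoc\<close>)
next
  case False
  then have mod3: "b * c mod 4 = 3" using assms(3) by simp
  then obtain c' where c': "c = Suc c'" by (cases c) auto
  define S where "S = b * c div 4"
  \<comment> \<open>Then \<open>3 b c = 4 (3 S + 2) + 1\<close>, so \<open>3 S + 2\<close> surplus
    pairs are required: \<open>S\<close> rotated triples and two opposite pairs.\<close>
  have S: "b * c = 4 * S + 3" using mod3 unfolding S_def by presburger
  have "odd (b * c)" using S by presburger
  then have z using assms(2) by (cases z) auto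
  then have b: "b = 3 + 2 * Q" using assms(2) by simp
  \<comment> \<open>The last array also houses the two opposite pairs, which occupy two
    columns.\<close>
  define cap where "cap j = (if j = c' then (b - 2) div 3 else b div 3)" for j
  have "b \<le> 4 * (b div 3)" "b \<le> 4 * ((b - 2) div 3) + 3" "b div 3 \<le> Q" "(b - 2) div 3 + 1 \<le> Q"
  proof -
    have "3 * (b div 3) \<le> b" "b \<le> 3 * (b div 3) + 2"
      "3 * ((b - 2) div 3) \<le> b - 2" "b - 2 \<le> 3 * ((b - 2) div 3) + 2"
      by linarith+
    then show "b \<le> 4 * (b div 3)" "b \<le> 4 * ((b - 2) div 3) + 3" "b div 3 \<le> Q" "(b - 2) div 3 + 1 \<le> Q"
      using b assms(1) by linarith+
  qed
  then have "b * c' + b \<le> 4 * (b div 3) * c' + (4 * ((b - 2) div 3) + 3)"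
    using mult_le_mono1 add_mono by blast
  moreover have "(\<Sum>j<c. cap j) = (b div 3) * c' + (b - 2) div 3"
    unfolding c' cap_def by simp
  ultimately have "S \<le> (\<Sum>j<c. cap j)" using S c' by simp
  then obtain f where f: "\<And>j. j < c \<Longrightarrow> f j \<le> cap j" "(\<Sum>j<c. f j) = S"
    using bounded_summands by blast
  show ?thesis
  proof (rule bands_9[where f = f and x = "\<lambda>j. of_bool (j = c')" and S = "3 * S + 2", OF assms(1,2)])
    fix j assume "j < c"
    then have "f j \<le> cap j" by (rule f)
    with \<open>b div 3 \<le> Q\<close> \<open>(b - 2) div 3 + 1 \<le> Q\<close> show "f j + of_bool (j = c') \<le> Q"
      by (auto simp: cap_def split: if_splits)
    show "3 * f j + 2 * of_bool (j = c') \<le> b"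
    proof -
      have "3 * cap j + 2 * of_bool (j = c') \<le> b"
      proof (cases "j = c'")
        case True
        have "b \<ge> 2" using b by simp
        then have "3 * ((b - 2) div 3) + 2 \<le> b" by linarith
        then show ?thesis using True by (simp add: cap_def)
      qed (simp add: cap_def)
      then show ?thesis using \<open>f j \<le> cap j\<close> by linarith
    qed
  next
    have "(\<Sum>j<c. of_bool (j = c') :: nat) = 1" unfolding c' by (simp add: of_bool_def)
    then show "3 * S + 2 = (\<Sum>j<c. 3 * f j + 2 * of_bool (j = c'))"
      using f(2) by (simp add: sum.distrib flip: sum_distrib_left)
  qed (use S in \<open>simp add: mult.assoc\<close>)
qed

section \<open>Families of zero-sum arrays\<close>

definition zero_sum_arrays :: "nat \<Rightarrow> nat \<Rightarrow> nat \<Rightarrow> bool" where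
  "zero_sum_arrays a b c \<longleftrightarrow> (\<exists>M. (\<forall>j<c. realizable (M j) (replicate a 0) (replicate b 0)) \<and>
     (\<Sum>j<c. M j) = interval 0 (a * b * c))"

lemma interval_snoc: "p = int k \<Longrightarrow> interval 0 k + interval p l = interval 0 (k + l)"
  using interval_add[of 0 k l] by simp

text \<open>Taking \<alpha> = 0 closes the gaps, and the two families are put behind the x values
  one after the other.\<close>

lemma bands_intervals:
  assumes "bands p C c e q"
  obtains T where "\<And>j. j < c \<Longrightarrow> realizable (T j) (replicate p 0) (C j)"
    "(\<Sum>j<c. T j) = interval 0 (3 * (e + q))"
proof -
  from assms obtain T where
    T: "\<forall>j<c. realizable (T j) (replicate p 0) (C j)"
      "(\<Sum>j<c. T j) = interval 0 (e + q)
       + (interval (int (e + q)) e + interval (int (e + q) + int e + 0) e)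
       + (interval (int (e + q + e + e)) q + interval (int (e + q + e + e) + int q + 0) q)"
    unfolding bands_def by (metis of_nat_0_le_iff order_refl)
  have "(\<Sum>j<c. T j) = interval 0 (e + q) + interval (int (e + q)) e + interval (int (e + q) + int e + 0) e
       + interval (int (e + q + e + e)) q + interval (int (e + q + e + e) + int q + 0) q"
    unfolding T(2) by (simp only: add.assoc)
  also have "\<dots> = interval 0 (e + q + e + e + q + q)"
    by (subst interval_snoc, simp)+ simp
  also have "e + q + e + e + q + q = 3 * (e + q)" by simp
  finally show ?thesis using T(1) that by blast
qed

lemma zero_sum_arrays_bands:
  assumes "bands p (\<lambda>j. replicate b 0) c e q" "3 * (e + q) = p * b * c"
  shows "zero_sum_arrays p b c"
  using bands_intervals[OF assms(1)] unfolding zero_sum_arrays_def assms(2) by metis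

text \<open>A region of height \<open>4 t\<close> with the same column surpluses is negated and put
  under each band. The regions use the numbers above those of the bands, \<open>8 t Q\<close> for
  each array.\<close>

lemma zero_sum_arrays_even:
  assumes bands: "bands p (\<lambda>j. pairs (D j)) c e q" and eq: "3 * (e + q) = p * (2 * Q) * c"
    and D: "\<And>j. j < c \<Longrightarrow> length (D j) = Q" and Qt: "Q \<ge> 2" "t \<ge> 1"
  shows "zero_sum_arrays (p + 4 * t) (2 * Q) c"
proof -
  obtain T where T: "\<And>j. j < c \<Longrightarrow> realizable (T j) (replicate p 0) (pairs (D j))"
    "(\<Sum>j<c. T j) = interval 0 (3 * (e + q))"
    using bands_intervals[OF bands] by blast
  let ?l = "8 * t * Q"
  let ?I = "\<lambda>j. interval (int (3 * (e + q)) + int (j * ?l)) ?l"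
  have "realizable (T j + ?I j) (replicate (p + 4 * t) 0) (replicate (2 * Q) 0)" if "j < c" for j
  proof -
    have "realizable (?I j) (pairs (strips False t)) (pairs (D j))"
      using realizable_region[of "int (3 * (e + q)) + int (j * ?l)" "D j" t False] D[OF that] Qt
      by simp
    then have "realizable (?I j) (map uminus (pairs (strips False t))) (map uminus (pairs (D j)))"
      by (rule realizable_uminus)
    moreover have "strips False t = replicate (2 * t) False"
      by (induction t) (simp_all add: strips_def)
    then have "map uminus (pairs (strips False t)) = replicate (4 * t) 0" by simp
    ultimately have "realizable (T j + ?I j) (replicate p 0 @ replicate (4 * t) 0)
        (map2 (+) (pairs (D j)) (map uminus (pairs (D j))))"
      using T(1)[OF that] by (intro realizable_append_rows) simp_all
    then show ?thesis
      using D[OF that] by (simp add: map2_plus_uminus[of _ "2 * Q"] replicate_add)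
  qed
  moreover have "(\<Sum>j<c. T j + ?I j) = interval 0 ((p + 4 * t) * (2 * Q) * c)"
  proof -
    have "(\<Sum>j<c. T j + ?I j) = interval 0 (3 * (e + q)) + interval (int (3 * (e + q))) (c * ?l)"
      unfolding sum.distrib T(2) interval_chunks ..
    also have "\<dots> = interval 0 (3 * (e + q) + c * ?l)" by (rule interval_snoc) simp
    also have "3 * (e + q) + c * ?l = (p + 4 * t) * (2 * Q) * c" unfolding eq by (simp add: algebra_simps)
    finally show ?thesis .
  qed
  ultimately show ?thesis
    unfolding zero_sum_arrays_def by (intro exI[of _ "\<lambda>j. T j + ?I j"] conjI allI impI)
qed

lemma bands_strips:
  assumes "t \<ge> 1"
  shows "bands 3 (\<lambda>j. pairs (strips True t)) c (2 * t * c) (2 * t * c)"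
proof -
  have "count_list (strips True t) d = t" for d
    by (induction t; cases d) (simp_all add: strips_def)
  then show ?thesis
    using bands_3[of c "\<lambda>j. strips True t" "2 * t * c" False "2 * t * c"] assms
    by (simp add: mult.commute)
qed

text \<open>The left three columns of the lower part are a transposed family of bands. It takes the first
  \<open>4 t c\<close> numbers as its \<open>x\<close>, and its pairs \<open>(y, z)\<close> fill the gaps in the two nested families
  of the upper bands.\<close>

lemma zero_sum_arrays_odd:
  assumes bands: "bands p (\<lambda>j. replicate 3 0 @ pairs (D j)) c e q"
    and eq: "3 * (e + q) = p * (3 + 2 * Q) * c"
    and D: "\<And>j. j < c \<Longrightarrow> length (D j) = Q" and Qt: "Q \<ge> 2" "t \<ge> 1"
  shows "zero_sum_arrays (p + 4 * t) (3 + 2 * Q) c"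
proof -
  define h where "h = 2 * t * c"
  define n where "n = e + q"
  \<comment> \<open>\<alpha> = 0, and the two families start where the gaps in the families of
    \<open>T\<close> start.\<close>
  obtain L where
    L: "\<forall>j<c. realizable (L j) (replicate 3 0) (pairs (strips True t))"
      "(\<Sum>j<c. L j) = interval 0 (h + h)
       + (interval (int (h + h + n + e)) h + interval (int (h + h + n + e) + int h + 0) h)
       + (interval (int (h + h + n + e + h + h + e + q)) h
          + interval (int (h + h + n + e + h + h + e + q) + int h + 0) h)"
    using bands_strips[OF Qt(2), of c] unfolding bands_def h_def[symmetric]
    by (metis of_nat_0_le_iff order_refl)
  \<comment> \<open>\<alpha> = \<open>h + h\<close> skips the x values of \<open>L\<close> and opens
    gaps of the length that a family of \<open>L\<close> fills with \<open>h\<close> values y and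
    \<open>h\<close> values z.\<close>
  obtain T where
    T: "\<forall>j<c. realizable (T j) (replicate p 0) (replicate 3 0 @ pairs (D j))"
      "(\<Sum>j<c. T j) = interval (int (h + h)) (e + q)
       + (interval (int (h + h + n)) e + interval (int (h + h + n) + int e + int (h + h)) e)
       + (interval (int (h + h + n + e + h + h + e)) q
          + interval (int (h + h + n + e + h + h + e) + int q + int (h + h)) q)"
    using bands unfolding bands_def by (metis of_nat_0_le_iff)
  have TL: "(\<Sum>j<c. T j) + (\<Sum>j<c. L j) = interval 0 (3 * n + 6 * h)"
  proof -
    \<comment> \<open>The ten intervals in increasing order, each starting where the one before
      ends.\<close>
    have "(\<Sum>j<c. T j) + (\<Sum>j<c. L j) = interval 0 (h + h) + interval (int (h + h)) n
        + interval (int (h + h + n)) e + interval (int (h + h + n + e)) h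
        + interval (int (h + h + n + e) + int h + 0) h
        + interval (int (h + h + n) + int e + int (h + h)) e
        + interval (int (h + h + n + e + h + h + e)) q
        + interval (int (h + h + n + e + h + h + e + q)) h
        + interval (int (h + h + n + e + h + h + e + q) + int h + 0) h
        + interval (int (h + h + n + e + h + h + e) + int q + int (h + h)) q"
      unfolding T(2) L(2) n_def[symmetric] by (simp only: add_ac)
    also have "\<dots> = interval 0 (h + h + n + e + h + h + e + q + h + h + q)"
      by (subst interval_snoc, simp)+ simp
    also have "h + h + n + e + h + h + e + q + h + h + q = 3 * n + 6 * h"
      unfolding n_def by simp
    finally show ?thesis .
  qed
  let ?l = "8 * t * Q"
  let ?I = "\<lambda>j. interval (int (3 * n + 6 * h) + int (j * ?l)) ?l"
  have "realizable (T j + (L j + ?I j)) (replicate (p + 4 * t) 0) (replicate (3 + 2 * Q) 0)"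
    if "j < c" for j
  proof -
    have "realizable (?I j) (pairs (strips True t)) (pairs (D j))"
      using realizable_region[of "int (3 * n + 6 * h) + int (j * ?l)" "D j" t True] D[OF that] Qt
      by simp
    then have "realizable (?I j) (map uminus (pairs (strips True t))) (map uminus (pairs (D j)))"
      by (rule realizable_uminus)
    moreover have "realizable (L j) (pairs (strips True t)) (replicate 3 0)"
      using L(1) that realizable_transpose by blast
    \<comment> \<open>The row surpluses of the transposed band cancel against those of the negated
      region.\<close>
    ultimately have "realizable (L j + ?I j)
        (map2 (+) (pairs (strips True t)) (map uminus (pairs (strips True t))))
        (replicate 3 0 @ map uminus (pairs (D j)))"
      by (intro realizable_append_cols) simp_all
    then have "realizable (L j + ?I j) (replicate (4 * t) 0) (map uminus (replicate 3 0 @ pairs (D j)))"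
      by (simp add: map2_plus_uminus[of _ "4 * t"])
    then have "realizable (T j + (L j + ?I j)) (replicate p 0 @ replicate (4 * t) 0)
        (map2 (+) (replicate 3 0 @ pairs (D j)) (map uminus (replicate 3 0 @ pairs (D j))))"
      using T(1) that by (intro realizable_append_rows) simp_all
    then show ?thesis
      using D[OF that] by (simp only: replicate_add[symmetric] map2_plus_uminus length_append
        length_replicate length_pairs)
  qed
  moreover have "(\<Sum>j<c. T j + (L j + ?I j)) = interval 0 ((p + 4 * t) * (3 + 2 * Q) * c)"
  proof -
    have "(\<Sum>j<c. T j + (L j + ?I j))
        = interval 0 (3 * n + 6 * h) + interval (int (3 * n + 6 * h)) (c * ?l)"
      unfolding sum.distrib add.assoc[symmetric] TL interval_chunks ..
    also have "\<dots> = interval 0 (3 * n + 6 * h + c * ?l)" by (rule interval_snoc) simp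
    also have "3 * n + 6 * h + c * ?l = (p + 4 * t) * (3 + 2 * Q) * c"
      using eq unfolding n_def h_def by (simp add: algebra_simps)
    finally show ?thesis .
  qed
  ultimately show ?thesis
    unfolding zero_sum_arrays_def by (intro exI[of _ "\<lambda>j. T j + (L j + ?I j)"] conjI allI impI)
qed

text \<open>If \<open>a\<close> is 3 modulo 4, the condition on \<open>a b c\<close> makes
  \<open>b c\<close> 0 or 1 modulo 4, which suits one band; if \<open>a\<close> is 1 modulo 4, it
  makes \<open>b c\<close> 0 or 3, which suits a stack of three bands.\<close>

theorem zero_sum_arrays_exist:
  assumes a: "odd a" "a \<ge> 7" and b: "b \<ge> 4" "b \<noteq> 5"
    and N: "a * b * c mod 4 = 0 \<or> a * b * c mod 4 = 3"
  shows "zero_sum_arrays a b c"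
proof (cases "c = 0")
  case True
  then show ?thesis by (simp add: zero_sum_arrays_def)
next
  case False
  define z where "z = odd b"
  define Q where "Q = (b - 3 * of_bool z) div 2"
  have bQ: "b = 3 * of_bool z + 2 * Q" "Q \<ge> 2"
    using b unfolding Q_def z_def by (auto elim!: oddE evenE)
  define r where "r = b * c mod 4"
  have r: "(a mod 4) * r mod 4 = 0 \<or> (a mod 4) * r mod 4 = 3"
    using N unfolding r_def by (simp only: mod_mult_eq mult.assoc)
  have "r < 4" unfolding r_def by simp
  then have r4: "r = 0 \<or> r = 1 \<or> r = 2 \<or> r = 3" by linarith
  have "a mod 4 = 1 \<or> a mod 4 = 3" using a(1) by presburger
  then show ?thesis
  proof
    assume a3: "a mod 4 = 3"
    define t where "t = a div 4"
    have t: "a = 3 + 4 * t" "t \<ge> 1"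
      using a3 a(2) div_mult_mod_eq[of a 4] unfolding t_def by linarith+
    have "b * c mod 4 \<le> 1" using r r4 unfolding a3 r_def[symmetric] by auto
    then obtain D e q where *: "\<forall>j. j < c \<longrightarrow> length (D j) = Q" "e + q = b * c"
      "bands 3 (\<lambda>j. replicate (3 * of_bool z) 0 @ pairs (D j)) c e q"
      using bands_3_exists[OF bQ(2,1), of c] False by auto
    show ?thesis
    proof (cases z)
      case True
      then show ?thesis
        using zero_sum_arrays_odd[of 3 D c e q Q t] * bQ t by simp
    next
      case False
      then show ?thesis
        using zero_sum_arrays_even[of 3 D c e q Q t] * bQ t by simp
    qed
  next
    assume a1: "a mod 4 = 1"
    \<comment> \<open>Here \<open>a\<close> is at least 9, so the subtraction is not
      truncated.\<close>
    define t where "t = a div 4 - 2"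
    have t: "a = 9 + 4 * t"
      using a1 a(2) div_mult_mod_eq[of a 4] unfolding t_def by linarith
    have bc: "b * c mod 4 = 0 \<or> b * c mod 4 = 3"
      using r r4 unfolding a1 r_def[symmetric] by auto
    obtain e q where *: "e + q = 3 * b * c" "bands 9 (\<lambda>j. replicate b 0) c e q"
      using bands_9_exists[OF bQ(2,1) bc] by (elim exE conjE)
    show ?thesis
    proof (cases "t \<ge> 1")
      case False
      then have "a = 9" using t by simp
      then show ?thesis using zero_sum_arrays_bands[OF *(2)] *(1) by simp
    next
      case True
      show ?thesis
      proof (cases z)
        case z: True
        \<comment> \<open>The nine upper rows already have column sums 0, so the rows below have no
          column surplus to absorb.\<close>
        have "replicate b 0 = replicate 3 0 @ pairs (replicate Q False)"
          using bQ z by (simp add: replicate_add)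
        then show ?thesis
          using zero_sum_arrays_odd[of 9 "\<lambda>_. replicate Q False" c e q Q t] * bQ t True z by simp
      next
        case z: False
        then show ?thesis
          using zero_sum_arrays_even[of 9 "\<lambda>_. replicate Q False" c e q Q t] * bQ t True by simp
      qed
    qed
  qed
qed

section \<open>Placing the arrays along a diagonal\<close>

lemma bij_betw_div_mod:
  assumes "(l::nat) > 0"
  shows "bij_betw (\<lambda>x. (x div l, x mod l)) {..<d * l} ({..<d} \<times> {..<l})"
proof (rule bij_betw_byWitness[where f' = "\<lambda>(r, w). r * l + w"])
  show "(\<lambda>x. (x div l, x mod l)) ` {..<d * l} \<subseteq> {..<d} \<times> {..<l}"
    using assms by (auto simp: less_mult_imp_div_less)
  show "(\<lambda>(r, w). r * l + w) ` ({..<d} \<times> {..<l}) \<subseteq> {..<d * l}"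
  proof clarsimp
    fix r w assume "r < d" "w < l"
    then have "r * l + w < Suc r * l" by simp
    also have "\<dots> \<le> d * l" using \<open>r < d\<close> by (intro mult_le_mono1) simp
    finally show "r * l + w < d * l" .
  qed
qed (use assms in auto)

lemma sum_div_mod:
  fixes f :: "nat \<Rightarrow> nat \<Rightarrow> 'a::comm_monoid_add"
  assumes "l > 0"
  shows "(\<Sum>x<d * l. f (x div l) (x mod l)) = (\<Sum>r<d. \<Sum>w<l. f r w)"
  using sum.reindex_bij_betw[OF bij_betw_div_mod[OF assms, of d], of "\<lambda>(r, w). f r w"]
  by (simp add: sum.cartesian_product case_prod_beta)

lemma zero_sum_arrays_family:
  assumes "zero_sum_arrays a b c"
  obtains F :: "nat \<Rightarrow> nat \<Rightarrow> nat \<Rightarrow> int" where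
    "\<And>I i. I < c \<Longrightarrow> i < a \<Longrightarrow> (\<Sum>j<b. F I i j) = 0"
    "\<And>I j. I < c \<Longrightarrow> j < b \<Longrightarrow> (\<Sum>i<a. F I i j) = 0"
    "(\<lambda>(I, i, j). \<bar>F I i j\<bar>) ` ({..<c} \<times> {..<a} \<times> {..<b}) = {1..int (a * b * c)}"
    "inj_on (\<lambda>(I, i, j). \<bar>F I i j\<bar>) ({..<c} \<times> {..<a} \<times> {..<b})"
proof -
  obtain M where M: "\<forall>I<c. realizable (M I) (replicate a 0) (replicate b 0)"
    "(\<Sum>I<c. M I) = interval 0 (a * b * c)"
    using assms unfolding zero_sum_arrays_def by blast
  then have ex: "\<forall>I\<in>{..<c}. \<exists>A. (\<forall>i<a. (\<Sum>j<b. A i j) = 0) \<and> (\<forall>j<b. (\<Sum>i<a. A i j) = 0) \<and>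
      (\<Sum>i<a. \<Sum>j<b. {#\<bar>A i j\<bar>#}) = M I"
    unfolding realizable_def by simp
  from bchoice[OF ex] obtain F where F: "\<forall>I\<in>{..<c}. (\<forall>i<a. (\<Sum>j<b. F I i j) = 0) \<and> (\<forall>j<b. (\<Sum>i<a. F I i j) = 0) \<and>
      (\<Sum>i<a. \<Sum>j<b. {#\<bar>F I i j\<bar>#}) = M I"
    by blast
  let ?S = "{..<c} \<times> {..<a} \<times> {..<b}"
  let ?f = "\<lambda>(I, i, j). \<bar>F I i j\<bar>"
  have "(\<Sum>I<c. \<Sum>i<a. \<Sum>j<b. {#\<bar>F I i j\<bar>#}) = interval 0 (a * b * c)"
    using F unfolding M(2)[symmetric] by (intro sum.cong) auto
  then have "set_mset (\<Sum>I<c. \<Sum>i<a. \<Sum>j<b. {#\<bar>F I i j\<bar>#}) = {1..int (a * b * c)}"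
    using set_interval[of 0 "a * b * c"] by simp
  moreover have "?f ` ?S = set_mset (\<Sum>I<c. \<Sum>i<a. \<Sum>j<b. {#\<bar>F I i j\<bar>#})"
    by (force simp: set_mset_sum)
  ultimately have image: "?f ` ?S = {1..int (a * b * c)}" by simp
  \<comment> \<open>Distinctness by counting: \<open>a b c\<close> cells cover \<open>a b c\<close>
    values.\<close>
  have "card (?f ` ?S) = a * b * c" unfolding image by (simp only: card_atLeastAtMost_int)
  also have "\<dots> = card ?S" by (simp add: mult.commute)
  finally have "card (?f ` ?S) = card ?S" .
  then have "inj_on ?f ?S" by (intro eq_card_imp_inj_on) auto
  with that[of F] F image show ?thesis by auto
qed

text \<open>In a \<open>c\<close> by \<open>c\<close> grid of blocks of size \<open>a\<close> by
  \<open>w\<close>, grid row \<open>I\<close> contains the \<open>d\<close> blocks of array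
  \<open>I\<close>, so its row sums are those of the array. A column meets \<open>d\<close>
  different blocks and runs through a complete column of an array in each. The bound
  \<open>d <= c\<close> keeps the offsets distinct.\<close>

lemma heffter_from_blocks:
  fixes a c d w :: nat
  assumes arr: "zero_sum_arrays a (d * w) c" and pos: "a > 0" "w > 0" "d > 0" and dc: "d \<le> c"
  shows "\<exists>A. heffter_int (a * c) (w * c) (d * w) (d * a) A"
proof -
  have c: "c > 0" using pos dc by simp
  obtain F :: "nat \<Rightarrow> nat \<Rightarrow> nat \<Rightarrow> int" where
    row: "\<And>I i. I < c \<Longrightarrow> i < a \<Longrightarrow> (\<Sum>j<d * w. F I i j) = 0"
    and col: "\<And>I j. I < c \<Longrightarrow> j < d * w \<Longrightarrow> (\<Sum>i<a. F I i j) = 0"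
    and image: "(\<lambda>(I, i, j). \<bar>F I i j\<bar>) ` ({..<c} \<times> {..<a} \<times> {..<d * w}) = {1..int (a * (d * w) * c)}"
    and inj: "inj_on (\<lambda>(I, i, j). \<bar>F I i j\<bar>) ({..<c} \<times> {..<a} \<times> {..<d * w})"
    using zero_sum_arrays_family[OF arr] by metis
  \<comment> \<open>This is J - I modulo \<open>c\<close> for I < \<open>c\<close>, written so that
    subtraction stays within the naturals.\<close>
  define off where "off I J = (J + (c - I)) mod c" for I J
  define A where "A i j = (if i < a * c \<and> j < w * c \<and> off (i div a) (j div w) < d
    then Some (F (i div a) (i mod a) (off (i div a) (j div w) * w + j mod w)) else None)" for i j
  have off_row: "off I ((I + r) mod c) = r" if "I < c" "r < c" for I r
  proof -
    have "off I ((I + r) mod c) = (I + r + (c - I)) mod c" unfolding off_def by (rule mod_add_left_eq)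
    also have "I + r + (c - I) = r + c" using that by simp
    finally show ?thesis using that by simp
  qed
  have off_row_inv: "(I + off I J) mod c = J" if "I < c" "J < c" for I J
  proof -
    have "(I + off I J) mod c = (I + (J + (c - I))) mod c" unfolding off_def by (rule mod_add_right_eq)
    also have "I + (J + (c - I)) = J + c" using that by simp
    finally show ?thesis using that by simp
  qed
  have off_col_inv: "(J + (c - off I J)) mod c = I" if "I < c" "J < c" for I J
  proof -
    have lt: "off I J < c" unfolding off_def using c by simp
    have "(J + (c - off I J)) mod c = ((I + off I J) mod c + (c - off I J)) mod c"
      using off_row_inv[OF that] by simp
    also have "\<dots> = (I + off I J + (c - off I J)) mod c" by (rule mod_add_left_eq)
    also have "I + off I J + (c - off I J) = I + c" using lt by simp
    finally show ?thesis using that by simp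
  qed
  have off_col: "off ((J + (c - r)) mod c) J = r" if "J < c" "r < c" for J r
  proof -
    let ?I = "(J + (c - r)) mod c"
    have "?I < c" using c by simp
    then have "(J + (c - off ?I J)) mod c = ?I" using off_col_inv that by blast
    moreover have "(r + (J + (c - r)) mod c) mod c = J"
    proof -
      have "(r + (J + (c - r)) mod c) mod c = (r + (J + (c - r))) mod c" by (rule mod_add_right_eq)
      also have "r + (J + (c - r)) = J + c" using that by simp
      finally show ?thesis using that by simp
    qed
    then have "off ?I ((?I + r) mod c) = off ?I J" by (simp add: add.commute)
    then show ?thesis using off_row[OF \<open>?I < c\<close> that(2)] by simp
  qed
  \<comment> \<open>The filled cells of a row are indexed by the offset of their block and the
    position in it.\<close>
  have row_bij: "bij_betw (\<lambda>(r, v). ((i div a + r) mod c) * w + v) ({..<d} \<times> {..<w})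
      {j. j < w * c \<and> A i j \<noteq> None}" if i: "i < a * c" for i
  proof (rule bij_betw_byWitness[where f' = "\<lambda>j. (off (i div a) (j div w), j mod w)"])
    have I: "i div a < c" using i by (simp add: less_mult_imp_div_less mult.commute)
    show "\<forall>x\<in>{..<d} \<times> {..<w}. (\<lambda>j. (off (i div a) (j div w), j mod w))
        ((\<lambda>(r, v). ((i div a + r) mod c) * w + v) x) = x"
      using I dc pos by (auto simp: off_row)
    show "\<forall>j\<in>{j. j < w * c \<and> A i j \<noteq> None}. (\<lambda>(r, v). ((i div a + r) mod c) * w + v)
        (off (i div a) (j div w), j mod w) = j"
      using I by (auto simp: off_row_inv less_mult_imp_div_less mult.commute)
    show "(\<lambda>(r, v). ((i div a + r) mod c) * w + v) ` ({..<d} \<times> {..<w}) \<subseteq> {j. j < w * c \<and> A i j \<noteq> None}"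
    proof clarsimp
      fix r v assume rv: "r < d" "v < w"
      let ?J = "(i div a + r) mod c"
      have "?J < c" using c by simp
      have "?J * w + v < Suc ?J * w" using rv by simp
      also have "\<dots> \<le> w * c" using \<open>?J < c\<close> by (metis Suc_leI mult.commute mult_le_mono1)
      finally show "?J * w + v < w * c \<and> (\<exists>y. A i (?J * w + v) = Some y)"
        using i rv off_row[OF I, of r] dc unfolding A_def by auto
    qed
    show "(\<lambda>j. (off (i div a) (j div w), j mod w)) ` {j. j < w * c \<and> A i j \<noteq> None} \<subseteq> {..<d} \<times> {..<w}"
      using pos by (auto simp: A_def split: if_splits)
  qed
  \<comment> \<open>In a column the offset \<open>r\<close> belongs to the grid row J -
    \<open>r\<close> modulo \<open>c\<close>.\<close>
  have col_bij: "bij_betw (\<lambda>(r, v). ((j div w + (c - r)) mod c) * a + v) ({..<d} \<times> {..<a})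
      {i. i < a * c \<and> A i j \<noteq> None}" if j: "j < w * c" for j
  proof (rule bij_betw_byWitness[where f' = "\<lambda>i. (off (i div a) (j div w), i mod a)"])
    have J: "j div w < c" using j by (simp add: less_mult_imp_div_less mult.commute)
    show "\<forall>x\<in>{..<d} \<times> {..<a}. (\<lambda>i. (off (i div a) (j div w), i mod a))
        ((\<lambda>(r, v). ((j div w + (c - r)) mod c) * a + v) x) = x"
    proof (intro ballI)
      fix x assume "x \<in> {..<d} \<times> {..<a}"
      then obtain r v where x: "x = (r, v)" "r < d" "v < a" by auto
      with off_col[OF J, of r] dc have "off ((j div w + (c - r)) mod c) (j div w) = r" by simp
      with x show "(\<lambda>i. (off (i div a) (j div w), i mod a))
        ((\<lambda>(r, v). ((j div w + (c - r)) mod c) * a + v) x) = x" by simp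
    qed
    show "\<forall>i\<in>{i. i < a * c \<and> A i j \<noteq> None}. (\<lambda>(r, v). ((j div w + (c - r)) mod c) * a + v)
        (off (i div a) (j div w), i mod a) = i"
      using J by (auto simp: off_col_inv less_mult_imp_div_less mult.commute)
    show "(\<lambda>(r, v). ((j div w + (c - r)) mod c) * a + v) ` ({..<d} \<times> {..<a}) \<subseteq> {i. i < a * c \<and> A i j \<noteq> None}"
    proof clarsimp
      fix r v assume rv: "r < d" "v < a"
      let ?I = "(j div w + (c - r)) mod c"
      have "?I < c" using c by simp
      have "?I * a + v < Suc ?I * a" using rv by simp
      also have "\<dots> \<le> a * c" using \<open>?I < c\<close> by (metis Suc_leI mult.commute mult_le_mono1)
      finally show "?I * a + v < a * c \<and> (\<exists>y. A (?I * a + v) j = Some y)"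
        using j rv off_col[OF J, of r] dc unfolding A_def by simp
    qed
    show "(\<lambda>i. (off (i div a) (j div w), i mod a)) ` {i. i < a * c \<and> A i j \<noteq> None} \<subseteq> {..<d} \<times> {..<a}"
      using pos by (auto simp: A_def split: if_splits)
  qed
  have entry: "i div a < c \<and> i mod a < a \<and> off (i div a) (j div w) * w + j mod w < d * w \<and>
      the (A i j) = F (i div a) (i mod a) (off (i div a) (j div w) * w + j mod w)"
    if "(i, j) \<in> filled A (a * c) (w * c)" for i j
  proof -
    have *: "i < a * c" "j < w * c" "off (i div a) (j div w) < d"
      using that by (auto simp: filled_def A_def split: if_splits)
    have "off (i div a) (j div w) * w + j mod w < Suc (off (i div a) (j div w)) * w" using pos by simp
    also have "\<dots> \<le> d * w" using *(3) by (intro mult_le_mono1) simp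
    finally show ?thesis
      using * pos by (simp add: A_def less_mult_imp_div_less mult.commute)
  qed
  show ?thesis
    unfolding heffter_int_def
  proof (intro exI[of _ A] conjI allI impI ballI)
    fix i j assume "i \<ge> a * c \<or> j \<ge> w * c"
    then show "A i j = None" by (auto simp: A_def)
  next
    fix i assume "i < a * c"
    from bij_betw_same_card[OF row_bij[OF this]]
    show "card {j. j < w * c \<and> A i j \<noteq> None} = d * w" by simp
  next
    fix j assume "j < w * c"
    from bij_betw_same_card[OF col_bij[OF this]]
    show "card {i. i < a * c \<and> A i j \<noteq> None} = d * a" by simp
  next
    fix x assume x: "x \<in> filled A (a * c) (w * c)"
    obtain i j where ij: "x = (i, j)" by (cases x)
    let ?k = "off (i div a) (j div w) * w + j mod w"
    have "(\<lambda>(I, i, j). \<bar>F I i j\<bar>) (i div a, i mod a, ?k) \<in> {1..int (a * (d * w) * c)}"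
      unfolding image[symmetric] using entry[of i j] x ij by (intro imageI) auto
    then show "case x of (i, j) \<Rightarrow> the (A i j) \<noteq> 0 \<and> \<bar>the (A i j)\<bar> \<le> int (w * c * (d * a))"
      using entry[of i j] x ij by (auto simp: mult_ac)
  next
    show "inj_on (\<lambda>(i, j). \<bar>the (A i j)\<bar>) (filled A (a * c) (w * c))"
    proof (rule inj_onI, clarify)
      fix i j i' j'
      assume ij: "(i, j) \<in> filled A (a * c) (w * c)" "(i', j') \<in> filled A (a * c) (w * c)"
        and eq: "\<bar>the (A i j)\<bar> = \<bar>the (A i' j')\<bar>"
      let ?r = "off (i div a) (j div w)" and ?r' = "off (i' div a) (j' div w)"
      have "(i div a, i mod a, ?r * w + j mod w) = (i' div a, i' mod a, ?r' * w + j' mod w)"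
        using inj_onD[OF inj, of "(i div a, i mod a, ?r * w + j mod w)" "(i' div a, i' mod a, ?r' * w + j' mod w)"]
          entry[OF ij(1)] entry[OF ij(2)] eq by auto
      then have 1: "i div a = i' div a" "i mod a = i' mod a" and 2: "?r * w + j mod w = ?r' * w + j' mod w"
        by auto
      from 1 have i: "i = i'" by (metis div_mult_mod_eq)
      have "?r = ?r'" "j mod w = j' mod w"
        using arg_cong[OF 2, of "\<lambda>x. x div w"] arg_cong[OF 2, of "\<lambda>x. x mod w"] pos by auto
      moreover have "j < w * c" "j' < w * c" using ij by (auto simp: filled_def)
      then have "j div w < c" "j' div w < c" by (simp_all add: less_mult_imp_div_less mult.commute)
      \<comment> \<open>Grid row and offset determine the grid column.\<close>
      then have "j div w = j' div w"
        using \<open>?r = ?r'\<close> off_row_inv[of "i div a"] entry[OF ij(1)] i by metis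
      ultimately show "i = i' \<and> j = j'" using i by (metis div_mult_mod_eq)
    qed
  next
    fix i assume i: "i < a * c"
    have I: "i div a < c" "i mod a < a" using i pos by (simp_all add: less_mult_imp_div_less mult.commute)
    have "(\<Sum>j\<in>{j. j < w * c \<and> A i j \<noteq> None}. the (A i j))
      = (\<Sum>(r, v)\<in>{..<d} \<times> {..<w}. the (A i (((i div a + r) mod c) * w + v)))"
      using sum.reindex_bij_betw[OF row_bij[OF i], of "\<lambda>j. the (A i j)"]
      by (simp add: case_prod_beta)
    also have "\<dots> = (\<Sum>(r, v)\<in>{..<d} \<times> {..<w}. F (i div a) (i mod a) (r * w + v))"
    proof (rule sum.cong, simp, clarify)
      fix r v assume rv: "r < d" "v < w"
      let ?j = "((i div a + r) mod c) * w + v"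
      have "?j \<in> {j. j < w * c \<and> A i j \<noteq> None}"
        using bij_betw_apply[OF row_bij[OF i], of "(r, v)"] rv by simp
      then have "(i, ?j) \<in> filled A (a * c) (w * c)" using i by (simp add: filled_def)
      from entry[OF this] show "the (A i ?j) = F (i div a) (i mod a) (r * w + v)"
        using rv off_row[OF I(1), of r] dc by simp
    qed
    also have "\<dots> = (\<Sum>x<d * w. F (i div a) (i mod a) x)"
      using sum_div_mod[OF pos(2), of "\<lambda>r v. F (i div a) (i mod a) (r * w + v)" d]
      by (simp add: sum.cartesian_product)
    finally show "(\<Sum>j\<in>{j. j < w * c \<and> A i j \<noteq> None}. the (A i j)) = 0"
      using row[OF I] by simp
  next
    fix j assume j: "j < w * c"
    have J: "j div w < c" "j mod w < w" using j pos by (simp_all add: less_mult_imp_div_less mult.commute)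
    have "(\<Sum>i\<in>{i. i < a * c \<and> A i j \<noteq> None}. the (A i j))
      = (\<Sum>(r, v)\<in>{..<d} \<times> {..<a}. the (A (((j div w + (c - r)) mod c) * a + v) j))"
      using sum.reindex_bij_betw[OF col_bij[OF j], of "\<lambda>i. the (A i j)"]
      by (simp add: case_prod_beta)
    also have "\<dots> = (\<Sum>(r, v)\<in>{..<d} \<times> {..<a}. F ((j div w + (c - r)) mod c) v (r * w + j mod w))"
    proof (rule sum.cong, simp, clarify)
      fix r v assume rv: "r < d" "v < a"
      let ?i = "((j div w + (c - r)) mod c) * a + v"
      have "?i \<in> {i. i < a * c \<and> A i j \<noteq> None}"
        using bij_betw_apply[OF col_bij[OF j], of "(r, v)"] rv by simp
      then have "(?i, j) \<in> filled A (a * c) (w * c)" using j by (simp add: filled_def)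
      from entry[OF this] show "the (A ?i j) = F ((j div w + (c - r)) mod c) v (r * w + j mod w)"
        using rv off_col[OF J(1), of r] dc by simp
    qed
    also have "\<dots> = (\<Sum>r<d. \<Sum>v<a. F ((j div w + (c - r)) mod c) v (r * w + j mod w))"
      by (simp add: sum.cartesian_product)
    \<comment> \<open>For fixed \<open>r\<close> the inner sum is a complete column of a single
      array.\<close>
    also have "\<dots> = 0"
    proof (rule sum.neutral, rule ballI)
      fix r assume "r \<in> {..<d}"
      then have "r * w + j mod w < Suc r * w" "Suc r * w \<le> d * w"
        using J by (simp, intro mult_le_mono1, simp)
      then show "(\<Sum>v<a. F ((j div w + (c - r)) mod c) v (r * w + j mod w)) = 0"
        using c by (intro col) auto
    qed
    finally show "(\<Sum>i\<in>{i. i < a * c \<and> A i j \<noteq> None}. the (A i j)) = 0" .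
  qed
qed

section \<open>Reduction to coprime block dimensions\<close>

theorem mainTheorem1:
  fixes m n s k :: nat
  assumes "3 \<le> s" and "s \<le> n" and "3 \<le> k" and "k \<le> m"
    and "m * s = n * k"
    and "(n * k) mod 4 = 0 \<or> (n * k) mod 4 = 3"
    and "odd k" and "k \<ge> 7 * gcd k s"
    and "s \<notin> {3, 5, 6, 10}"
  shows "\<exists>A. heffter_int m n s k A"
proof -
  define d where "d = gcd k s"
  have d: "d > 0" unfolding d_def using assms(1) by simp
  obtain a w where aw: "k = a * d" "s = w * d" "coprime a w"
    using gcd_coprime_exists[of k s] d unfolding d_def by auto
  have pos: "a > 0" "w > 0" using aw assms(1,3) by (auto intro!: Nat.gr0I)
  have "m * w = n * a" using assms(5) d unfolding aw by simp
  then have "a dvd m * w" by simp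
  \<comment> \<open>After division by the gcd, \<open>a\<close> is coprime to \<open>w\<close>, so
    it divides \<open>m\<close>; the quotient \<open>c\<close> is the number of arrays.\<close>
  then have "a dvd m" using aw(3) by (simp add: coprime_dvd_mult_left_iff)
  then obtain c where c: "m = a * c" by blast
  then have n: "n = w * c" using \<open>m * w = n * a\<close> pos by (simp add: mult.commute)
  \<comment> \<open>\<open>s <= n\<close> reads \<open>w d <= w c\<close>.\<close>
  have "d \<le> c" using assms(2) pos unfolding aw n by simp
  have "odd a" using assms(7) aw by simp
  have "7 * d \<le> k" using assms(8) unfolding d_def .
  then have "a \<ge> 7" using d unfolding aw by simp
  have "n * k = a * (d * w) * c" unfolding aw n by simp
  then have "zero_sum_arrays a (d * w) c"
    using assms(1,6,9) \<open>odd a\<close> \<open>a \<ge> 7\<close> aw(2)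
    by (intro zero_sum_arrays_exist) (auto simp: mult.commute)
  from heffter_from_blocks[OF this pos d \<open>d \<le> c\<close>] show ?thesis
    unfolding aw c n by (simp add: mult.commute)
qed

end
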